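(* Let $(X,d,\mu)$, $p$, $\underline{Q}_\mu$ be as in the context. Fix $\underline{\theta}\in[0,\min\{p,\underline{Q}_\mu\})$, $\theta\in[\underline{\theta},p)$, an integer $N\ge2$, numbers $0<\theta_1<\dots<\theta_N=\underline{\theta}$, closed sets $S^i\in\mathcal{ADR}_{\theta_i}(X)$, $S:=\bigcup_{i=1}^NS^i$, and $\mathfrak m_k:=\sum_{i=1}^N2^{k(\theta-\theta_i)}\mathcal H_{\theta_i}\lfloor_{S^i}$, $k\in\mathbb N_0$. For each $i$ let $\sigma_i\in(0,1)$ be such that $S^i$ is $\sigma_i$-porous, and put $\sigma(S):=\prod_{i=1}^N\frac{2\sigma_i}{3}$. Then for each $\sigma\in(0,\sigma(S)]$ there is a constant $C>0$ such that $$\operatorname{BN}_{p,\{\mathfrak m_k\},\sigma}(f)\le C\Big(\sum_{i=1}^N\|f|\mathrm B^{1-\theta_i/p}_p(S^i)\|+\mathcal{GL}^{(1)}_p(f)\Big)\quad\text{for all } f\in\bigcap_{i=1}^NL_p(\mathcal H_{\theta_i}\lfloor_{S^i}).$$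
   Context: Standing setting: $(X,d)$ complete separable metric space, $\mu$ a Borel regular locally finite outer measure, $\operatorname{supp}\mu=X$, uniformly locally doubling (for every $R>0$, $\sup_{r\in(0,R]}\sup_x\mu(B_{2r}(x))/\mu(B_r(x))<\infty$). Balls are closed, $B_r(x)=\{y:d(x,y)\le r\}$, $cB_r(x)=B_{cr}(x)$, $B_k(x)=B_{2^{-k}}(x)$. A fixed $p\in(1,\infty)$; $X$ supports a weak local $(1,p)$-Poincaré inequality (for every $R>0$ there are $C,\lambda\ge1$ with $\inf_c\frac{1}{\mu(B_r(x))}\int_{B_r(x)}|f-c|d\mu\le Cr(\frac{1}{\mu(B_{\lambda r}(x))}\int_{B_{\lambda r}(x)}(\operatorname{lip}f)^pd\mu)^{1/p}$ for Lipschitz $f$, $x\in X$, $r\in(0,R]$, with $\operatorname{lip}f(y)=\limsup_{z\to y}|f(y)-f(z)|/d(y,z)$). $\underline{Q}_\mu$ is the infimum of $Q>0$ such that for every $R>0$ there is $C$ with $(r_{B'}/r_B)^Q\le C\mu(B')/\mu(B)$ for balls $B'\subset B$, $0<r_{B'}\le r_B\le R$. Notation: $\mathrm{Av}_{G,\mathfrak m}(g)=\mathfrak m(G)^{-1}\int_Gg\,d\mathfrak m$ if $\mathfrak m(G)>0$, else $0$; $\mathcal E_{\mathfrak m}(g,G):=\inf_{c\in\mathbb R}\mathrm{Av}_{G,\mathfrak m}(|g-c|)$; $\mathfrak m\lfloor_S(E)=\mathfrak m(E\cap S)$. $\mathcal H_{\vartheta,\delta}(E):=\inf\{\sum\mu(B_{r_i}(x_i))r_i^{-\vartheta}:E\subset\bigcup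 B_{r_i}(x_i),0<r_i<\delta\}$, $\mathcal H_\vartheta=\lim_{\delta\to0}\mathcal H_{\vartheta,\delta}$. $\mathcal{ADR}_\vartheta(X)$: closed $S'$ with $\varkappa_1\mu(B_r(x))r^{-\vartheta}\le\mathcal H_\vartheta(B_r(x)\cap S')\le\varkappa_2\mu(B_r(x))r^{-\vartheta}$ for $x\in S'$, $r\in(0,1]$. Porosity: a ball $B$ is $(S',\sigma)$-porous if there is a ball $B'\subset B\setminus S'$ with $r(B')\ge\sigma r(B)$; $S'_r(\sigma):=\{x\in S':B_r(x)\text{ is }(S',\sigma)\text{-porous}\}$; $S'$ is $\sigma$-porous if $S'_r(\sigma)=S'$ for all $r\in(0,1]$. Besov norm: for $S'\in\mathcal{ADR}_\vartheta(X)$, $s>0$: $\|f|\mathrm B^s_p(S')\|:=\|f|L_p(\mathcal H_\vartheta\lfloor_{S'})\|+(\sum_{k\ge1}2^{ksp}\int_{S'}(\mathcal E_{\mathcal H_\vartheta\lfloor_{S'}}(f,B_k(x)))^pd\mathcal H_\vartheta(x))^{1/p}$. Functional $\operatorname{BN}$: for $r>0$ let $k(r)$ be the integer with $r\in(2^{-k(r)-1},2^{-k(r)}]$; $\widetilde{\mathcal E}_{\mathfrak m_k}(f,B_r(x)):=\mathcal E_{\mathfrak m_k}(f,B_{2r}(x))$ if $B_r(x)\cap S\ne\emptyset$ and $0$ otherwise; $f^\sharp(x):=\sup_{r\in(0,1]}\frac1r\widetilde{\mathcal E}_{\mathfrak m_{k(r)}}(f,B_r(x))$, $x\in X$. Then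 $\operatorname{BN}_{p,\{\mathfrak m_k\},\sigma}(f):=\|f|L_p(\mathfrak m_0)\|+\|f^\sharp|L_p(S,\mu)\|+\big(\sum_{k\ge1}2^{k(\theta-p)}\int_{S_{2^{-k}}(\sigma)}(\mathcal E_{\mathfrak m_k}(f,B_k(x)))^pd\mathfrak m_k(x)\big)^{1/p}$. Gluing functional: $\Sigma^{i,j}_k:=\{(y,z)\in S^i\times S^j:d(y,z)\le2^{-k}\}$, $\operatorname{w}_k(y,z):=(\mu(B_k(y))\mu(B_k(z)))^{-1/2}$, $\mathcal{GL}^{(1)}_p(f):=\big(\sum_{i\ne j}\sum_{k\ge1}2^{k(p-\theta_i-\theta_j)}\iint_{\Sigma^{i,j}_k}\operatorname{w}_k(y,z)|f(y)-f(z)|^pd\mathcal H_{\theta_i}(y)d\mathcal H_{\theta_j}(z)\big)^{1/p}$. *)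

theory Defs
  imports "HOL-Analysis.Analysis"
begin

definition epow :: "ennreal \<Rightarrow> real \<Rightarrow> ennreal" where
  "epow x q = (if x = \<infinity> then \<infinity> else ennreal (enn2real x powr q))"

text \<open>The outer measure mu is represented by its restriction to Borel sets
  (a Borel measure M with sets M = sets borel); only values on closed balls
  are ever used. Balls are closed: cball x r.\<close>

definition lip :: "('a::metric_space \<Rightarrow> real) \<Rightarrow> 'a \<Rightarrow> ennreal" where
  "lip f y = e2ennreal (Limsup (at y) (\<lambda>z. ereal (\<bar>f y - f z\<bar> / dist y z)))"

definition Av :: "'a measure \<Rightarrow> 'a set \<Rightarrow> ('a \<Rightarrow> ennreal) \<Rightarrow> ennreal" where
  "Av m G g = (if emeasure m G > 0 then (\<integral>\<^sup>+x. g x * indicator G x \<partial>m) / emeasure m G else 0)"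

definition Eosc :: "'a measure \<Rightarrow> ('a \<Rightarrow> real) \<Rightarrow> 'a set \<Rightarrow> ennreal" where
  "Eosc m g G = (INF c::real. Av m G (\<lambda>y. ennreal \<bar>g y - c\<bar>))"

definition standing_space :: "'a::{complete_space, second_countable_topology} measure \<Rightarrow> real \<Rightarrow> bool" where
  "standing_space M p \<longleftrightarrow>
     sets M = sets borel \<and>
     (\<forall>x. \<exists>r>0. emeasure M (cball x r) < \<infinity>) \<and>
     (\<forall>x r. r > 0 \<longrightarrow> emeasure M (cball x r) > 0) \<and>
     (\<forall>R>0. \<exists>C::real. \<forall>r\<in>{0<..R}. \<forall>x. emeasure M (cball x (2*r)) \<le> ennreal C * emeasure M (cball x r)) \<and>
     1 < p \<and>
     (\<forall>R>0. \<exists>C \<ge> 1. \<exists>lam\<ge>(1::real). \<forall>f::'a \<Rightarrow> real. (\<exists>L. L-lipschitz_on UNIV f) \<longrightarrow>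
        (\<forall>x. \<forall>r\<in>{0<..R}.
          (INF c::real. Av M (cball x r) (\<lambda>y. ennreal \<bar>f y - c\<bar>))
            \<le> ennreal (C * r) * epow (Av M (cball x (lam*r)) (\<lambda>y. epow (lip f y) p)) (1/p)))"

definition Qlow :: "'a::metric_space measure \<Rightarrow> real" where
  "Qlow M = Inf {Q::real. Q > 0 \<and> (\<forall>R>0. \<exists>C::real. \<forall>x x' r r'.
       cball x' r' \<subseteq> cball x r \<longrightarrow> 0 < r' \<longrightarrow> r' \<le> r \<longrightarrow> r \<le> R \<longrightarrow>
         ennreal ((r'/r) powr Q) * emeasure M (cball x r) \<le> ennreal C * emeasure M (cball x' r'))}"

definition Hdelta :: "'a::metric_space measure \<Rightarrow> real \<Rightarrow> real \<Rightarrow> 'a set \<Rightarrow> ennreal" where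
  "Hdelta M vt \<delta> E = (INF F \<in> {F::('a \<times> real) set. countable F \<and> (\<forall>(x,r)\<in>F. 0 < r \<and> r < \<delta>)
        \<and> E \<subseteq> (\<Union>(x,r)\<in>F. cball x r)}.
      \<integral>\<^sup>+b. emeasure M (cball (fst b) (snd b)) * ennreal (snd b powr (-vt)) \<partial>count_space F)"

definition Hcal :: "'a::metric_space measure \<Rightarrow> real \<Rightarrow> 'a set \<Rightarrow> ennreal" where
  "Hcal M vt E = (SUP \<delta>\<in>{0<..}. Hdelta M vt \<delta> E)"

definition Hrestr :: "'a::metric_space measure \<Rightarrow> real \<Rightarrow> 'a set \<Rightarrow> 'a measure" where
  "Hrestr M vt S = measure_of UNIV (sets borel) (\<lambda>E. Hcal M vt (E \<inter> S))"

definition ADR :: "'a::metric_space measure \<Rightarrow> real \<Rightarrow> 'a set \<Rightarrow> bool" where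
  "ADR M vt S' \<longleftrightarrow> closed S' \<and> (\<exists>k1 k2::real. 0 < k1 \<and> 0 < k2 \<and>
     (\<forall>x\<in>S'. \<forall>r\<in>{0<..1}.
        ennreal k1 * emeasure M (cball x r) * ennreal (r powr (-vt)) \<le> Hcal M vt (cball x r \<inter> S') \<and>
        Hcal M vt (cball x r \<inter> S') \<le> ennreal k2 * emeasure M (cball x r) * ennreal (r powr (-vt))))"

definition porous_ball :: "'a::metric_space set \<Rightarrow> real \<Rightarrow> 'a \<Rightarrow> real \<Rightarrow> bool" where
  "porous_ball S' \<sigma> x r \<longleftrightarrow> (\<exists>y r'. r' \<ge> \<sigma> * r \<and> cball y r' \<subseteq> cball x r - S')"

definition porous_part :: "'a::metric_space set \<Rightarrow> real \<Rightarrow> real \<Rightarrow> 'a set" where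
  "porous_part S' r \<sigma> = {x\<in>S'. porous_ball S' \<sigma> x r}"

definition porous :: "'a::metric_space set \<Rightarrow> real \<Rightarrow> bool" where
  "porous S' \<sigma> \<longleftrightarrow> (\<forall>r\<in>{0<..1}. porous_part S' r \<sigma> = S')"

definition Lpnorm :: "'a measure \<Rightarrow> real \<Rightarrow> ('a \<Rightarrow> real) \<Rightarrow> ennreal" where
  "Lpnorm m p f = epow (\<integral>\<^sup>+x. epow (ennreal \<bar>f x\<bar>) p \<partial>m) (1/p)"

definition Besov :: "'a::metric_space measure \<Rightarrow> real \<Rightarrow> real \<Rightarrow> real \<Rightarrow> 'a set \<Rightarrow> ('a \<Rightarrow> real) \<Rightarrow> ennreal" where
  "Besov M vt s p S' f =
     Lpnorm (Hrestr M vt S') p f +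
     epow (\<Sum>k. ennreal (2 powr (real (Suc k) * s * p)) *
        (\<integral>\<^sup>+x. epow (Eosc (Hrestr M vt S') f (cball x ((1/2)^(Suc k)))) p \<partial>Hrestr M vt S')) (1/p)"

text \<open>k(r): the integer k with r in (2^(-k-1), 2^(-k)]; only used for r in (0,1].\<close>
definition kr :: "real \<Rightarrow> nat" where
  "kr r = (THE k::nat. (1/2)^(k+1) < r \<and> r \<le> (1/2)^k)"

definition Etilde :: "(nat \<Rightarrow> 'a measure) \<Rightarrow> 'a::metric_space set \<Rightarrow> ('a \<Rightarrow> real) \<Rightarrow> 'a \<Rightarrow> real \<Rightarrow> ennreal" where
  "Etilde m S f x r = (if cball x r \<inter> S \<noteq> {} then Eosc (m (kr r)) f (cball x (2*r)) else 0)"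

definition sharp :: "(nat \<Rightarrow> 'a measure) \<Rightarrow> 'a::metric_space set \<Rightarrow> ('a \<Rightarrow> real) \<Rightarrow> 'a \<Rightarrow> ennreal" where
  "sharp m S f x = (SUP r\<in>{0<..1}. ennreal (1/r) * Etilde m S f x r)"

definition BN :: "'a::metric_space measure \<Rightarrow> real \<Rightarrow> real \<Rightarrow> (nat \<Rightarrow> 'a measure) \<Rightarrow> 'a set \<Rightarrow> real \<Rightarrow> ('a \<Rightarrow> real) \<Rightarrow> ennreal" where
  "BN M p \<theta> m S \<sigma> f =
     Lpnorm (m 0) p f +
     epow (\<integral>\<^sup>+x. epow (sharp m S f x) p * indicator S x \<partial>M) (1/p) +
     epow (\<Sum>k. ennreal (2 powr (real (Suc k) * (\<theta> - p))) *
        (\<integral>\<^sup>+x. epow (Eosc (m (Suc k)) f (cball x ((1/2)^(Suc k)))) p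
              * indicator (porous_part S ((1/2)^(Suc k)) \<sigma>) x \<partial>m (Suc k))) (1/p)"

definition weight :: "'a::metric_space measure \<Rightarrow> nat \<Rightarrow> 'a \<Rightarrow> 'a \<Rightarrow> ennreal" where
  "weight M k y z = inverse (epow (emeasure M (cball y ((1/2)^k)) * emeasure M (cball z ((1/2)^k))) (1/2))"

definition GL :: "'a::metric_space measure \<Rightarrow> real \<Rightarrow> nat \<Rightarrow> (nat \<Rightarrow> real) \<Rightarrow> (nat \<Rightarrow> 'a set) \<Rightarrow> ('a \<Rightarrow> real) \<Rightarrow> ennreal" where
  "GL M p N th S f = epow
     (\<Sum>(i,j)\<in>{(i,j). i \<in> {1..N} \<and> j \<in> {1..N} \<and> i \<noteq> j}.
       \<Sum>k. ennreal (2 powr (real (Suc k) * (p - th i - th j))) *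
         (\<integral>\<^sup>+z. \<integral>\<^sup>+y. indicator {(y,z). dist y z \<le> (1/2)^(Suc k)} (y,z) *
              weight M (Suc k) y z * epow (ennreal \<bar>f y - f z\<bar>) p \<partial>Hrestr M (th i) (S i) \<partial>Hrestr M (th j) (S j)))
     (1/p)"

definition mk :: "'a::metric_space measure \<Rightarrow> real \<Rightarrow> nat \<Rightarrow> (nat \<Rightarrow> real) \<Rightarrow> (nat \<Rightarrow> 'a set) \<Rightarrow> nat \<Rightarrow> 'a measure" where
  "mk M \<theta> N th S k = measure_of UNIV (sets borel)
     (\<lambda>E. \<Sum>i\<in>{1..N}. ennreal (2 powr (real k * (\<theta> - th i))) * emeasure (Hrestr M (th i) (S i)) E)"

end

theory Submission
  imports Defs
begin

text \<open>Since every \<open>\<theta>\<^sub>i\<close> is positive, the sets \<open>S\<^sup>i\<close> are \<open>\<mu>\<close>-null and the \<open>f\<^sup>\<sharp>\<close> term of \<open>BN\<close>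
  vanishes; its \<open>L\<^sub>p(\<mm>\<^sub>0)\<close> term is bounded by the \<open>L\<^sub>p\<close> parts of the Besov norms.
  In the remaining sum, let \<open>x \<in> S\<^sup>i\<close>, \<open>k \<ge> 2\<close> and \<open>B = B\<^sub>k(x)\<close>. The \<open>\<mm>\<^sub>k\<close>-oscillation of \<open>f\<close> on \<open>B\<close> is at
  most the \<open>\<mm>\<^sub>k\<close>-mean of \<open>\<bar>f - f(y)\<bar>\<close> for every \<open>y\<close>; averaging over \<open>y \<in> S\<^sup>i \<inter> B\<close> leaves the oscillation
  with respect to \<open>\<H>\<^sub>\<theta>\<^sub>i\<close> and averages of \<open>\<bar>f(y) - f(z)\<bar>\<close> over \<open>y \<in> S\<^sup>i \<inter> B\<close>, \<open>z \<in> S\<^sup>j \<inter> B\<close>, \<open>j \<noteq> i\<close>.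
  After Jensen's inequality and Fubini's theorem, doubling and Ahlfors regularity turn the latter into the
  level \<open>k - 1\<close> part of the gluing functional, because \<open>y, z \<in> B\<close> only gives \<open>d(y,z) \<le> 2 * 2\<^sup>-\<^sup>k\<close>.
  Level \<open>k = 1\<close>, where no such part is available, is controlled by the \<open>L\<^sub>p\<close> norms alone.\<close>

subsection \<open>Powers of extended nonnegative reals\<close>

lemma epow_0 [simp]: "epow 0 q = 0"
  by (simp add: epow_def)

lemma epow_top [simp]: "epow \<infinity> q = \<infinity>" "epow top q = top"
  by (simp_all add: epow_def)

lemma epow_ennreal: "0 \<le> x \<Longrightarrow> epow (ennreal x) q = ennreal (x powr q)"
  by (simp add: epow_def)

lemma epow_eq_0_iff [simp]: "epow x q = 0 \<longleftrightarrow> x = 0"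
  by (cases x) (auto simp: epow_ennreal)

lemma epow_mono:
  assumes "x \<le> y" "0 \<le> q" shows "epow x q \<le> epow y q"
proof (cases y)
  case (real r)
  then obtain s where "x = ennreal s" "0 \<le> s" "s \<le> r"
    using assms by (cases x) (auto simp: top_unique)
  with real assms show ?thesis
    by (simp add: epow_ennreal ennreal_leI powr_mono2)
qed simp

lemma epow_mult: "epow (x * y) q = epow x q * epow y q"
proof (cases "x = 0 \<or> y = 0")
  case False
  then show ?thesis
    by (cases x; cases y)
      (auto simp: epow_ennreal powr_mult ennreal_mult[symmetric] ennreal_mult_top ennreal_top_mult)
qed auto

lemma borel_measurable_epow [measurable (raw)]:
  assumes [measurable]: "g \<in> borel_measurable N"
  shows "(\<lambda>x. epow (g x) q) \<in> borel_measurable N"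
  unfolding epow_def by measurable

lemma epow_sum_le_card:
  assumes "finite I" "0 \<le> q"
  shows "epow (\<Sum>i\<in>I. u i) q \<le> ennreal (real (card I) powr q) * (\<Sum>i\<in>I. epow (u i) q)"
proof (cases "I = {}")
  case False
  have "Max (u ` I) \<in> u ` I"
    using assms False by (intro Max_in) auto
  then obtain l where l: "l \<in> I" "Max (u ` I) = u l"
    by auto
  have "(\<Sum>i\<in>I. u i) \<le> of_nat (card I) * u l"
    using assms by (intro sum_bounded_above) (simp flip: l(2))
  then have "epow (\<Sum>i\<in>I. u i) q \<le> epow (ennreal (real (card I)) * u l) q"
    using assms by (intro epow_mono) (auto simp: ennreal_of_nat_eq_real_of_nat)
  also have "\<dots> = ennreal (real (card I) powr q) * epow (u l) q"
    by (simp add: epow_mult epow_ennreal)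
  also have "\<dots> \<le> ennreal (real (card I) powr q) * (\<Sum>i\<in>I. epow (u i) q)"
    using assms l by (intro mult_left_mono member_le_sum) auto
  finally show ?thesis .
qed simp

lemma epow_add_le:
  assumes q: "0 \<le> q" "q \<le> 1"
  shows "epow (x + y) q \<le> epow x q + epow y q"
proof (cases "x = top \<or> y = top \<or> x + y = 0")
  case False
  then obtain a b where ab: "x = ennreal a" "y = ennreal b" "0 \<le> a" "0 \<le> b" "0 < a + b"
    by (cases x; cases y) (auto simp: add_nonneg_eq_0_iff less_le)
  have "c / (a + b) \<le> (c / (a + b)) powr q" if "0 \<le> c" "c \<le> a + b" for c
    using that ab q powr_mono'[of q 1 "c / (a + b)"] by (cases "c = 0") auto
  from this[of a] this[of b] have "a / (a + b) + b / (a + b) \<le> (a powr q + b powr q) / (a + b) powr q"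
    using ab by (simp add: powr_divide add_divide_distrib)
  then have "(a + b) powr q \<le> a powr q + b powr q"
    using ab by (simp add: pos_le_divide_eq flip: add_divide_distrib)
  then show ?thesis
    using ab by (simp add: epow_ennreal ennreal_leI flip: ennreal_plus)
qed auto

lemma epow_sum_le:
  assumes "finite I" "0 \<le> q" "q \<le> 1"
  shows "epow (\<Sum>i\<in>I. u i) q \<le> (\<Sum>i\<in>I. epow (u i) q)"
  using assms(1)
proof induction
  case (insert i I)
  then show ?case
    using assms(2,3) by (auto intro: order_trans[OF epow_add_le add_left_mono])
qed simp

lemma le_Young_epow:
  assumes p: "1 \<le> p" and A: "0 < A"
  shows "x \<le> ennreal ((1 - 1 / p) * A) + ennreal (A powr (1 - p) / p) * epow x p"
proof (cases "x = 0 \<or> x = top")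
  case False
  then obtain t where t: "x = ennreal t" "0 < t"
    by (cases x) auto
  have "A powr (1 - 1 / p) * (A powr (1 - p) * t powr p) powr (1 / p) = A powr ((1 - 1 / p) + (1 - p) / p) * t"
    using p A t by (simp add: powr_mult powr_powr powr_add)
  also have "(1 - 1 / p) + (1 - p) / p = 0"
    using p by (simp add: field_simps)
  finally have "t \<le> (1 - 1 / p) * A + 1 / p * (A powr (1 - p) * t powr p)"
    using Youngs_inequality_0[of "1 - 1 / p" "1 / p" A "A powr (1 - p) * t powr p"] p A t
    by simp
  then show ?thesis
    using t p A by (simp add: epow_ennreal ennreal_leI flip: ennreal_mult ennreal_plus)
qed (use p A in \<open>auto simp: ennreal_mult_top\<close>)

lemma nn_integral_le_Young_epow:
  assumes p: "1 \<le> p" and A: "0 < A"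
    and [measurable]: "g \<in> borel_measurable N" and N: "emeasure N (space N) \<le> 1"
  shows "(\<integral>\<^sup>+x. g x \<partial>N) \<le> ennreal ((1 - 1 / p) * A) + ennreal (A powr (1 - p) / p) * (\<integral>\<^sup>+x. epow (g x) p \<partial>N)"
proof -
  have "(\<integral>\<^sup>+x. g x \<partial>N) \<le> (\<integral>\<^sup>+x. ennreal ((1 - 1 / p) * A) + ennreal (A powr (1 - p) / p) * epow (g x) p \<partial>N)"
    by (intro nn_integral_mono le_Young_epow p A)
  also have "\<dots> = ennreal ((1 - 1 / p) * A) * emeasure N (space N)
      + ennreal (A powr (1 - p) / p) * (\<integral>\<^sup>+x. epow (g x) p \<partial>N)"
    by (simp add: nn_integral_add nn_integral_cmult)
  also have "\<dots> \<le> ennreal ((1 - 1 / p) * A) * 1 + ennreal (A powr (1 - p) / p) * (\<integral>\<^sup>+x. epow (g x) p \<partial>N)"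
    by (intro add_right_mono mult_left_mono N) simp
  finally show ?thesis
    by simp
qed

text \<open>Jensen's inequality: integrate Young's inequality with \<open>A\<close> the \<open>L\<^sub>p\<close> norm of \<open>g\<close>.\<close>

lemma epow_nn_integral_le:
  assumes p: "1 \<le> p" and g [measurable]: "g \<in> borel_measurable N" and N: "emeasure N (space N) \<le> 1"
  shows "epow (\<integral>\<^sup>+x. g x \<partial>N) p \<le> (\<integral>\<^sup>+x. epow (g x) p \<partial>N)" (is "_ \<le> ?R")
proof -
  consider "?R = 0" | "?R = top" | R where "?R = ennreal R" "0 < R"
    by (cases ?R) (auto simp: less_le)
  then show ?thesis
  proof cases
    case 1
    then have "(\<integral>\<^sup>+x. g x \<partial>N) = 0"
      by (simp add: nn_integral_0_iff_AE)
    then show ?thesis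
      by simp
  next
    case (3 R)
    define A where "A = R powr (1 / p)"
    have A: "0 < A" "A powr p = R"
      using 3(2) p by (auto simp: A_def powr_powr)
    have "A powr (1 - p) * R = A"
      using A by (simp flip: A(2) powr_add)
    then have "(1 - 1 / p) * A + A powr (1 - p) / p * R = A"
      using p by (simp add: field_simps)
    then have "(\<integral>\<^sup>+x. g x \<partial>N) \<le> ennreal A"
      using nn_integral_le_Young_epow[OF p A(1) g N] p A(1) 3 by (simp flip: ennreal_mult ennreal_plus)
    then have "epow (\<integral>\<^sup>+x. g x \<partial>N) p \<le> epow (ennreal A) p"
      using p by (intro epow_mono) auto
    then show ?thesis
      using A 3(1) by (simp add: epow_ennreal)
  qed simp
qed

lemma epow_set_nn_integral_le:
  assumes "1 \<le> p" and [measurable]: "g \<in> borel_measurable N" "B \<in> sets N"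
    and c: "c * emeasure N B \<le> 1"
  shows "epow (c * (\<integral>\<^sup>+x\<in>B. g x \<partial>N)) p \<le> c * (\<integral>\<^sup>+x\<in>B. epow (g x) p \<partial>N)"
proof -
  let ?D = "density N (\<lambda>x. c * indicator B x)"
  have density: "(\<integral>\<^sup>+x. h x \<partial>?D) = c * (\<integral>\<^sup>+x\<in>B. h x \<partial>N)" if [measurable]: "h \<in> borel_measurable N" for h
    by (simp add: nn_integral_density nn_integral_cmult[symmetric] ac_simps)
  have "emeasure ?D (space ?D) = c * emeasure N B"
    by (simp add: emeasure_density nn_integral_cmult_indicator cong: nn_integral_cong)
  then show ?thesis
    using epow_nn_integral_le[of p g ?D] assms by (simp add: density)
qed

subsection \<open>Weighted sums of Borel measures\<close>

definition sum_measure ::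
    "'i set \<Rightarrow> ('i \<Rightarrow> ennreal) \<Rightarrow> ('i \<Rightarrow> 'a::topological_space measure) \<Rightarrow> 'a measure" where
  "sum_measure I c H = measure_of UNIV (sets borel) (\<lambda>E. \<Sum>i\<in>I. c i * emeasure (H i) E)"

lemma sets_sum_measure: "sets (sum_measure I c H) = sets borel"
  unfolding sum_measure_def
  by (subst sets_measure_of) (auto simp: sets.sigma_sets_eq[of borel, simplified])

lemma emeasure_sum_measure:
  fixes H :: "'i \<Rightarrow> 'a::topological_space measure"
  assumes H: "\<And>i. i \<in> I \<Longrightarrow> sets (H i) = sets borel" and E: "E \<in> sets borel"
  shows "emeasure (sum_measure I c H) E = (\<Sum>i\<in>I. c i * emeasure (H i) E)"
proof (rule emeasure_measure_of[OF sum_measure_def])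
  show "countably_additive (sets (sum_measure I c H)) (\<lambda>E. \<Sum>i\<in>I. c i * emeasure (H i) E)"
  proof (rule countably_additiveI)
    fix A :: "nat \<Rightarrow> 'a set"
    assume A: "range A \<subseteq> sets (sum_measure I c H)" "disjoint_family A"
    have "(\<Sum>n. c i * emeasure (H i) (A n)) = c i * emeasure (H i) (\<Union>n. A n)" if "i \<in> I" for i
      using A H[OF that] by (simp add: suminf_emeasure sets_sum_measure)
    then show "(\<Sum>n. \<Sum>i\<in>I. c i * emeasure (H i) (A n)) = (\<Sum>i\<in>I. c i * emeasure (H i) (\<Union>n. A n))"
      by (subst suminf_sum) auto
  qed
qed (use E in \<open>auto simp: positive_def sets_sum_measure\<close>)

lemma nn_integral_sum_measure:
  assumes H: "\<And>i. i \<in> I \<Longrightarrow> sets (H i) = sets borel" and g: "g \<in> borel_measurable borel"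
  shows "(\<integral>\<^sup>+x. g x \<partial>sum_measure I c H) = (\<Sum>i\<in>I. c i * (\<integral>\<^sup>+x. g x \<partial>H i))"
  using g
proof induction
  case (cong f g)
  then have "f = g"
    by auto
  with cong show ?case
    by simp
next
  case (set A)
  then show ?case
    by (simp add: nn_integral_indicator sets_sum_measure emeasure_sum_measure H cong: sum.cong)
next
  case (mult u a)
  then show ?case
    by (simp add: nn_integral_cmult measurable_cong_sets[OF sets_sum_measure refl] sum_distrib_left
        measurable_cong_sets[OF H refl] ac_simps cong: sum.cong)
next
  case (add u v)
  then show ?case
    by (simp add: nn_integral_add measurable_cong_sets[OF sets_sum_measure refl] sum.distrib distrib_left
        measurable_cong_sets[OF H refl] cong: sum.cong)
next
  case (seq U)
  have mono: "incseq (\<lambda>n. c i * (\<integral>\<^sup>+x. U n x \<partial>H i))" for i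
    using seq(3) by (intro incseq_SucI mult_left_mono nn_integral_mono) (auto simp: incseq_Suc_iff le_fun_def)
  have "(\<integral>\<^sup>+x. (SUP n. U n) x \<partial>sum_measure I c H) = (SUP n. \<integral>\<^sup>+x. U n x \<partial>sum_measure I c H)"
    using seq by (simp add: image_comp nn_integral_monotone_convergence_SUP
        measurable_cong_sets[OF sets_sum_measure refl])
  also have "\<dots> = (SUP n. \<Sum>i\<in>I. c i * (\<integral>\<^sup>+x. U n x \<partial>H i))"
    using seq by simp
  also have "\<dots> = (\<Sum>i\<in>I. SUP n. c i * (\<integral>\<^sup>+x. U n x \<partial>H i))"
    using mono by (intro ennreal_SUP_sum) auto
  also have "\<dots> = (\<Sum>i\<in>I. c i * (\<integral>\<^sup>+x. (SUP n. U n) x \<partial>H i))"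
    using seq by (intro sum.cong refl) (simp add: image_comp nn_integral_monotone_convergence_SUP
        measurable_cong_sets[OF H refl] SUP_mult_left_ennreal)
  finally show ?case .
qed

subsection \<open>Averages and oscillations\<close>

lemma Av_eq_divide:
  assumes "G \<in> sets m"
  shows "Av m G g = (\<integral>\<^sup>+x\<in>G. g x \<partial>m) / emeasure m G"
proof (cases "emeasure m G = 0")
  case True
  then have "G \<in> null_sets m"
    using assms by auto
  then show ?thesis
    using True by (simp add: Av_def nn_integral_null_set)
qed (simp add: Av_def zero_less_iff_neq_zero)

lemma Av_mono: "(\<And>x. x \<in> G \<Longrightarrow> g x \<le> h x) \<Longrightarrow> Av m G g \<le> Av m G h"
  unfolding Av_def
  by (auto intro!: divide_right_mono_ennreal nn_integral_mono split: split_indicator)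

lemma Av_add:
  assumes "G \<in> sets m" "g \<in> borel_measurable m" "h \<in> borel_measurable m"
  shows "Av m G (\<lambda>x. g x + h x) = Av m G g + Av m G h"
  using assms by (simp add: Av_def distrib_right nn_integral_add add_divide_distrib_ennreal)

lemma Av_sum:
  assumes "G \<in> sets m" "\<And>j. j \<in> J \<Longrightarrow> g j \<in> borel_measurable m"
  shows "Av m G (\<lambda>x. \<Sum>j\<in>J. g j x) = (\<Sum>j\<in>J. Av m G (g j))"
  using assms(2)
proof (induction J rule: infinite_finite_induct)
  case (insert j J)
  then show ?case
    using assms(1) by (simp add: Av_add)
qed (simp_all add: Av_def)

lemma Av_const_le:
  assumes "G \<in> sets m"
  shows "Av m G (\<lambda>_. c) \<le> c"
  using assms by (cases "emeasure m G = top")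
    (auto simp: Av_def nn_integral_cmult less_top ennreal_mult_divide_eq)

lemma Av_const:
  assumes "G \<in> sets m" "0 < emeasure m G" "emeasure m G < \<infinity>"
  shows "Av m G (\<lambda>_. c) = c"
  using assms by (simp add: Av_def nn_integral_cmult ennreal_mult_divide_eq)

lemma epow_Av_le:
  assumes "1 \<le> p" "G \<in> sets m" "g \<in> borel_measurable m"
  shows "epow (Av m G g) p \<le> Av m G (\<lambda>x. epow (g x) p)"
proof -
  have "inverse (emeasure m G) * emeasure m G \<le> 1"
    by (cases "emeasure m G = 0"; cases "emeasure m G")
      (auto simp: inverse_ennreal ennreal_mult[symmetric])
  then show ?thesis
    using epow_set_nn_integral_le[of p g m G "inverse (emeasure m G)"] assms
    by (simp add: Av_eq_divide divide_ennreal_def mult.commute)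
qed

lemma Av_sum_measure:
  assumes H: "\<And>i. i \<in> I \<Longrightarrow> sets (H i) = sets borel"
    and [measurable]: "g \<in> borel_measurable borel" "B \<in> sets borel"
  shows "Av (sum_measure I c H) B g =
    (\<Sum>i\<in>I. c i / emeasure (sum_measure I c H) B * (\<integral>\<^sup>+x\<in>B. g x \<partial>H i))"
  by (simp add: Av_eq_divide sets_sum_measure nn_integral_sum_measure[OF H] divide_ennreal_def
      sum_distrib_left ac_simps)

lemma Eosc_le_Av: "Eosc m f B \<le> Av m B (\<lambda>y. ennreal \<bar>f y - c\<bar>)"
  unfolding Eosc_def by (rule INF_lower) simp

lemma Eosc_eq_INF_Rats:
  assumes [measurable]: "G \<in> sets m" "g \<in> borel_measurable m"
  shows "Eosc m g G = (INF c\<in>\<rat>. Av m G (\<lambda>y. ennreal \<bar>g y - c\<bar>))"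
proof (rule antisym)
  show "Eosc m g G \<le> (INF c\<in>\<rat>. Av m G (\<lambda>y. ennreal \<bar>g y - c\<bar>))"
    by (intro INF_greatest Eosc_le_Av)
  have "(INF c\<in>\<rat>. Av m G (\<lambda>y. ennreal \<bar>g y - c\<bar>)) \<le> Av m G (\<lambda>y. ennreal \<bar>g y - c\<bar>)" for c
  proof (rule ennreal_le_epsilon)
    fix e :: real assume e: "0 < e"
    obtain q where q: "q \<in> \<rat>" "c < q" "q < c + e"
      using Rats_dense_in_real[of c "c + e"] e by auto
    have "Av m G (\<lambda>y. ennreal \<bar>g y - q\<bar>) \<le> Av m G (\<lambda>y. ennreal \<bar>g y - c\<bar> + ennreal e)"
      using q by (intro Av_mono) (auto simp flip: ennreal_plus intro!: ennreal_leI)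
    also have "\<dots> \<le> Av m G (\<lambda>y. ennreal \<bar>g y - c\<bar>) + ennreal e"
      by (simp add: Av_add Av_const_le add_left_mono)
    finally show "(INF c\<in>\<rat>. Av m G (\<lambda>y. ennreal \<bar>g y - c\<bar>)) \<le> Av m G (\<lambda>y. ennreal \<bar>g y - c\<bar>) + ennreal e"
      using q by (meson INF_lower2)
  qed
  then show "(INF c\<in>\<rat>. Av m G (\<lambda>y. ennreal \<bar>g y - c\<bar>)) \<le> Eosc m g G"
    unfolding Eosc_def by (intro INF_greatest)
qed

text \<open>\<open>Eosc m f B\<close> is at most the average of \<open>\<bar>f z - c\<bar>\<close> for every \<open>c\<close>, in particular for \<open>c = f y\<close>.\<close>

lemma Eosc_le_Av_Av:
  assumes "B \<in> sets H" "0 < emeasure H B" "emeasure H B < \<infinity>"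
  shows "Eosc m f B \<le> Av H B (\<lambda>y. Av m B (\<lambda>z. ennreal \<bar>f z - f y\<bar>))"
proof -
  have "Eosc m f B = Av H B (\<lambda>_. Eosc m f B)"
    using assms by (simp add: Av_const)
  also have "\<dots> \<le> Av H B (\<lambda>y. Av m B (\<lambda>z. ennreal \<bar>f z - f y\<bar>))"
    by (intro Av_mono Eosc_le_Av)
  finally show ?thesis .
qed

lemma Av_Av_le_Eosc:
  assumes [measurable]: "B \<in> sets H" "f \<in> borel_measurable H"
  shows "Av H B (\<lambda>y. Av H B (\<lambda>z. ennreal \<bar>f z - f y\<bar>)) \<le> 2 * Eosc H f B"
proof -
  have "Av H B (\<lambda>y. Av H B (\<lambda>z. ennreal \<bar>f z - f y\<bar>)) / 2 \<le> Av H B (\<lambda>y. ennreal \<bar>f y - c\<bar>)" (is "_ \<le> ?A") for c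
  proof (rule divide_le_posI_ennreal)
    have "Av H B (\<lambda>y. Av H B (\<lambda>z. ennreal \<bar>f z - f y\<bar>))
        \<le> Av H B (\<lambda>y. Av H B (\<lambda>z. ennreal \<bar>f z - c\<bar> + ennreal \<bar>f y - c\<bar>))"
      by (intro Av_mono) (auto simp flip: ennreal_plus intro!: ennreal_leI)
    also have "\<dots> \<le> Av H B (\<lambda>y. ?A + ennreal \<bar>f y - c\<bar>)"
      by (intro Av_mono) (simp add: Av_add Av_const_le add_left_mono)
    also have "\<dots> \<le> ?A + ?A"
      by (simp add: Av_add Av_const_le add_right_mono)
    finally show "Av H B (\<lambda>y. Av H B (\<lambda>z. ennreal \<bar>f z - f y\<bar>)) \<le> 2 * ?A"
      by (simp add: mult_2)
  qed simp
  then have "Av H B (\<lambda>y. Av H B (\<lambda>z. ennreal \<bar>f z - f y\<bar>)) / 2 \<le> Eosc H f B"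
    unfolding Eosc_def by (intro INF_greatest)
  then have "2 * (Av H B (\<lambda>y. Av H B (\<lambda>z. ennreal \<bar>f z - f y\<bar>)) / 2) \<le> 2 * Eosc H f B"
    by (rule mult_left_mono) simp
  then show ?thesis
    by (simp add: ennreal_times_divide ennreal_mult_divide_eq mult.commute[of 2])
qed

lemma mult_emeasure_le_emeasure_sum_measure:
  assumes "finite I" "i \<in> I" "\<And>i. i \<in> I \<Longrightarrow> sets (H i) = sets borel" "B \<in> sets borel"
  shows "c i * emeasure (H i) B \<le> emeasure (sum_measure I c H) B"
  using assms member_le_sum[of i I "\<lambda>i. c i * emeasure (H i) B"] by (simp add: emeasure_sum_measure)

definition pair_energy :: "real \<Rightarrow> 'a measure \<Rightarrow> 'a measure \<Rightarrow> ('a \<Rightarrow> real) \<Rightarrow> 'a set \<Rightarrow> ennreal" where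
  "pair_energy p H H' f B = (\<integral>\<^sup>+y\<in>B. (\<integral>\<^sup>+z\<in>B. epow (ennreal \<bar>f z - f y\<bar>) p \<partial>H') \<partial>H)"

context
  fixes I :: "'i set" and i :: 'i and c :: "'i \<Rightarrow> ennreal"
    and H :: "'i \<Rightarrow> 'a::topological_space measure" and B :: "'a set" and f :: "'a \<Rightarrow> real"
  assumes I: "finite I" "i \<in> I"
    and H: "\<And>j. j \<in> I \<Longrightarrow> sets (H j) = sets borel" "\<And>j. j \<in> I \<Longrightarrow> sigma_finite_measure (H j)"
    and c: "\<And>j. j \<in> I \<Longrightarrow> 0 < c j"
    and B [measurable]: "B \<in> sets borel" "0 < emeasure (H i) B" "emeasure (H i) B < \<infinity>"
    and f [measurable]: "f \<in> borel_measurable borel"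
begin

lemma coeff_div_sum_measure_le:
  assumes "j \<in> I"
  shows "c j / emeasure (sum_measure I c H) B * emeasure (H j) B \<le> 1"
proof -
  have le: "c j * emeasure (H j) B \<le> emeasure (sum_measure I c H) B" if "j \<in> I" for j
    by (rule mult_emeasure_le_emeasure_sum_measure) (use I H B that in auto)
  have "0 < c i * emeasure (H i) B"
    using c[OF I(2)] B by (simp add: ennreal_zero_less_mult_iff)
  then have "0 < emeasure (sum_measure I c H) B"
    using le[OF I(2)] by (rule less_le_trans)
  then have "c j * emeasure (H j) B / emeasure (sum_measure I c H) B \<le> 1"
    using le[OF assms] by (intro divide_le_posI_ennreal) auto
  then show ?thesis
    by (simp add: divide_ennreal_def ac_simps)
qed

lemma Eosc_sum_measure_le:
  "Eosc (sum_measure I c H) f B \<le> 2 * Eosc (H i) f B +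
    (\<Sum>j\<in>I - {i}. Av (H i) B (\<lambda>y. c j / emeasure (sum_measure I c H) B * (\<integral>\<^sup>+z\<in>B. ennreal \<bar>f z - f y\<bar> \<partial>H j)))"
    (is "Eosc ?m _ _ \<le> _")
proof -
  let ?J = "\<lambda>j y. c j / emeasure ?m B * (\<integral>\<^sup>+z\<in>B. ennreal \<bar>f z - f y\<bar> \<partial>H j)"
  note [measurable_cong] = H(1)[OF I(2)]
  have J: "?J j \<in> borel_measurable (H i)" if "j \<in> I" for j
  proof -
    interpret sigma_finite_measure "H j" using that by (rule H)
    note [measurable_cong] = H(1)[OF that]
    show ?thesis by measurable
  qed
  have "Eosc ?m f B \<le> Av (H i) B (\<lambda>y. Av ?m B (\<lambda>z. ennreal \<bar>f z - f y\<bar>))"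
    by (rule Eosc_le_Av_Av) (use B H(1)[OF I(2)] in auto)
  also have "\<dots> = Av (H i) B (\<lambda>y. ?J i y + (\<Sum>j\<in>I - {i}. ?J j y))"
    using I by (simp add: Av_sum_measure H sum.remove)
  also have "\<dots> = Av (H i) B (?J i) + Av (H i) B (\<lambda>y. \<Sum>j\<in>I - {i}. ?J j y)"
    using I H(1)[OF I(2)] J by (intro Av_add borel_measurable_sum) auto
  also have "Av (H i) B (\<lambda>y. \<Sum>j\<in>I - {i}. ?J j y) = (\<Sum>j\<in>I - {i}. Av (H i) B (?J j))"
    using H(1)[OF I(2)] J by (intro Av_sum) auto
  also have "Av (H i) B (?J i) \<le> Av (H i) B (\<lambda>y. Av (H i) B (\<lambda>z. ennreal \<bar>f z - f y\<bar>))"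
  proof (rule Av_mono)
    fix y
    have "c i / emeasure ?m B = (c i / emeasure ?m B * emeasure (H i) B) / emeasure (H i) B"
      using B by (simp add: mult_divide_eq_ennreal)
    also have "\<dots> \<le> 1 / emeasure (H i) B"
      by (intro divide_right_mono_ennreal coeff_div_sum_measure_le I)
    finally have "?J i y \<le> 1 / emeasure (H i) B * (\<integral>\<^sup>+z\<in>B. ennreal \<bar>f z - f y\<bar> \<partial>H i)"
      by (rule mult_right_mono) simp
    then show "?J i y \<le> Av (H i) B (\<lambda>z. ennreal \<bar>f z - f y\<bar>)"
      using H(1)[OF I(2)] by (simp add: Av_eq_divide divide_ennreal_def mult.commute)
  qed
  also have "\<dots> \<le> 2 * Eosc (H i) f B"
    by (rule Av_Av_le_Eosc) (use H I in auto)
  finally show ?thesis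
    by (simp add: add_right_mono)
qed

lemma epow_Eosc_sum_measure_le:
  assumes p: "1 \<le> p"
  shows "epow (Eosc (sum_measure I c H) f B) p \<le> ennreal (real (card I) powr p) *
    (ennreal (2 powr p) * epow (Eosc (H i) f B) p +
      (\<Sum>j\<in>I - {i}. inverse (emeasure (H i) B) * (c j / emeasure (sum_measure I c H) B) *
        pair_energy p (H i) (H j) f B))"
    (is "epow (Eosc ?m _ _) _ \<le> _")
proof -
  let ?J = "\<lambda>j y. c j / emeasure ?m B * (\<integral>\<^sup>+z\<in>B. ennreal \<bar>f z - f y\<bar> \<partial>H j)"
  define u where "u j = (if j = i then 2 * Eosc (H i) f B else Av (H i) B (?J j))" for j
  have J: "epow (Av (H i) B (?J j)) p \<le> inverse (emeasure (H i) B) * (c j / emeasure ?m B) *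
        pair_energy p (H i) (H j) f B" if j: "j \<in> I" for j
  proof -
    interpret sigma_finite_measure "H j" using j by (rule H)
    note [measurable_cong] = H(1)[OF I(2)] H(1)[OF j]
    have "epow (Av (H i) B (?J j)) p \<le> Av (H i) B (\<lambda>y. epow (?J j y) p)"
      by (rule epow_Av_le) (use p in auto)
    also have "\<dots> \<le> Av (H i) B (\<lambda>y. c j / emeasure ?m B * (\<integral>\<^sup>+z\<in>B. epow (ennreal \<bar>f z - f y\<bar>) p \<partial>H j))"
      by (intro Av_mono epow_set_nn_integral_le p coeff_div_sum_measure_le j) measurable
    also have "\<dots> = inverse (emeasure (H i) B) * (c j / emeasure ?m B) * pair_energy p (H i) (H j) f B"
      unfolding pair_energy_def
      by (simp add: Av_eq_divide mult.assoc nn_integral_cmult) (simp add: divide_ennreal_def ac_simps)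
    finally show ?thesis .
  qed
  have "epow (Eosc ?m f B) p \<le> epow (\<Sum>j\<in>I. u j) p"
    using Eosc_sum_measure_le I p by (intro epow_mono) (simp_all add: u_def sum.remove[of I i])
  also have "\<dots> \<le> ennreal (real (card I) powr p) * (\<Sum>j\<in>I. epow (u j) p)"
    using I p by (intro epow_sum_le_card) auto
  also have "(\<Sum>j\<in>I. epow (u j) p) = epow (2 * Eosc (H i) f B) p + (\<Sum>j\<in>I - {i}. epow (Av (H i) B (?J j)) p)"
    using I by (simp add: u_def sum.remove[of I i])
  also have "epow (2 * Eosc (H i) f B) p = ennreal (2 powr p) * epow (Eosc (H i) f B) p"
    using epow_ennreal[of 2 p] by (simp add: epow_mult)
  finally show ?thesis
    by (rule order_trans) (intro mult_left_mono add_left_mono sum_mono J; simp)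
qed

end

subsection \<open>Borel measures on separable metric spaces\<close>

lemma cball_subset_cball_double:
  assumes "dist x y \<le> r"
  shows "cball y r \<subseteq> cball x (2 * r)"
proof
  fix u assume "u \<in> cball y r"
  then show "u \<in> cball x (2 * r)"
    using assms dist_triangle[of x u y] by simp
qed

lemma countable_ball_cover:
  fixes r :: "'a::{metric_space,second_countable_topology} \<Rightarrow> real"
  assumes "\<And>x. 0 < r x"
  obtains X where "countable X" "(\<Union>x\<in>X. ball x (r x)) = UNIV"
proof -
  obtain F where F: "F \<subseteq> range (\<lambda>x. ball x (r x))" "countable F" "\<Union>F = \<Union>(range (\<lambda>x. ball x (r x)))"
    by (rule Lindelof[of "range (\<lambda>x. ball x (r x))"]) auto
  then obtain X where X: "countable X" "F = (\<lambda>x. ball x (r x)) ` X"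
    by (meson countable_subset_image)
  have "x \<in> ball x (r x)" for x
    using assms[of x] by simp
  then have "(\<Union>x\<in>X. ball x (r x)) = UNIV"
    using F(3) unfolding X(2) by blast
  with X(1) show ?thesis
    by (rule that)
qed

lemma sigma_finite_measure_locally_finite:
  fixes m :: "'a::{metric_space,second_countable_topology} measure"
  assumes m: "sets m = sets borel" and fin: "\<And>x. \<exists>r>0. emeasure m (cball x r) < \<infinity>"
  shows "sigma_finite_measure m"
proof
  obtain r where r: "0 < r x" "emeasure m (cball x (r x)) < \<infinity>" for x
    using fin by metis
  obtain X where X: "countable X" "(\<Union>x\<in>X. ball x (r x)) = UNIV"
    using r(1) by (rule countable_ball_cover)
  have "(\<Union>x\<in>X. cball x (r x)) = UNIV"
    using X(2) ball_subset_cball by blast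
  then show "\<exists>A. countable A \<and> A \<subseteq> sets m \<and> \<Union>A = space m \<and> (\<forall>a\<in>A. emeasure m a \<noteq> \<infinity>)"
    using X(1) r(2) m sets_eq_imp_space_eq[OF m]
    by (intro exI[of _ "(\<lambda>x. cball x (r x)) ` X"]) (auto simp: less_top)
qed

lemma null_sets_locally:
  fixes A :: "'a::{metric_space,second_countable_topology} set"
  assumes null: "\<And>x. \<exists>r>0. ball x r \<inter> A \<in> null_sets m"
  shows "A \<in> null_sets m"
proof -
  obtain r where r: "0 < r x" "ball x (r x) \<inter> A \<in> null_sets m" for x
    using null by metis
  obtain X where X: "countable X" "(\<Union>x\<in>X. ball x (r x)) = UNIV"
    using r(1) by (rule countable_ball_cover)
  have "(\<Union>x\<in>X. ball x (r x) \<inter> A) \<in> null_sets m"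
    using X(1) r(2) by (rule null_sets_UN')
  also have "(\<Union>x\<in>X. ball x (r x) \<inter> A) = A"
    using X(2) by auto
  finally show ?thesis .
qed

lemma borel_measurable_indicator_cball [measurable (raw)]:
  fixes f g :: "'b \<Rightarrow> 'a::{metric_space,second_countable_topology}"
  assumes [measurable]: "f \<in> borel_measurable N" "g \<in> borel_measurable N"
  shows "(\<lambda>w. indicator (cball (f w) r) (g w) :: ennreal) \<in> borel_measurable N"
proof -
  have "(\<lambda>w. indicator (cball (f w) r) (g w) :: ennreal) = (\<lambda>w. if dist (f w) (g w) \<le> r then 1 else 0)"
    by (auto simp: fun_eq_iff)
  then show ?thesis
    by simp
qed

lemma borel_measurable_emeasure_cball:
  fixes m :: "'a::{metric_space,second_countable_topology} measure"
  assumes m [measurable_cong]: "sets m = sets borel" and "sigma_finite_measure m"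
  shows "(\<lambda>x. emeasure m (cball x r)) \<in> borel_measurable borel"
proof -
  interpret sigma_finite_measure m by fact
  have "(\<lambda>x. emeasure m (cball x r)) = (\<lambda>x. \<integral>\<^sup>+y. indicator (cball x r) y \<partial>m)"
    using m by (auto simp: fun_eq_iff)
  then show ?thesis
    by (simp only:) measurable
qed

lemma borel_measurable_Eosc_cball:
  fixes m :: "'a::{metric_space,second_countable_topology} measure"
  assumes m [measurable_cong]: "sets m = sets borel" and "sigma_finite_measure m"
    and [measurable]: "f \<in> borel_measurable borel"
  shows "(\<lambda>x. Eosc m f (cball x r)) \<in> borel_measurable borel"
proof -
  interpret sigma_finite_measure m by fact
  have [measurable]: "(\<lambda>x. emeasure m (cball x r)) \<in> borel_measurable borel"
    using assms by (intro borel_measurable_emeasure_cball)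
  have "(\<lambda>x. Eosc m f (cball x r)) = (\<lambda>x. INF c\<in>\<rat>. Av m (cball x r) (\<lambda>y. ennreal \<bar>f y - c\<bar>))"
    by (intro ext Eosc_eq_INF_Rats) (auto simp: m)
  also have "\<dots> \<in> borel_measurable borel"
    unfolding Av_def by (intro borel_measurable_INF countable_rat) measurable
  finally show ?thesis .
qed

lemma borel_measurable_pair_energy_cball:
  fixes H H' :: "'a::{metric_space,second_countable_topology} measure"
  assumes [measurable_cong]: "sets H = sets borel" "sets H' = sets borel"
    and "sigma_finite_measure H" "sigma_finite_measure H'" and [measurable]: "f \<in> borel_measurable borel"
  shows "(\<lambda>x. pair_energy p H H' f (cball x r)) \<in> borel_measurable borel"
proof -
  interpret H: sigma_finite_measure H by fact
  interpret H': sigma_finite_measure H' by fact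
  show ?thesis
    unfolding pair_energy_def by measurable
qed

subsection \<open>Codimension-regular measures on a doubling space\<close>

locale doubling_measure =
  fixes M :: "'a::{metric_space,second_countable_topology} measure" and Cd :: real
  assumes sets_M [measurable_cong]: "sets M = sets borel"
    and finite_cball: "emeasure M (cball x r) < \<infinity>"
    and pos_cball: "0 < r \<Longrightarrow> 0 < emeasure M (cball x r)"
    and doubling: "0 < r \<Longrightarrow> r \<le> 1 \<Longrightarrow> emeasure M (cball x (2 * r)) \<le> ennreal Cd * emeasure M (cball x r)"
    and Cd_ge_1: "1 \<le> Cd"
begin

sublocale sigma_finite_measure M
  using sets_M by (rule sigma_finite_measure_locally_finite) (use finite_cball zero_less_one in blast)

definition V :: "real \<Rightarrow> 'a \<Rightarrow> real" where
  "V r x = measure M (cball x r)"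

lemma emeasure_cball: "emeasure M (cball x r) = ennreal (V r x)"
  unfolding V_def using finite_cball[of x r] by (intro emeasure_eq_ennreal_measure) (simp add: less_top)

lemma V_pos: "0 < r \<Longrightarrow> 0 < V r x"
  using pos_cball[of r x] unfolding emeasure_cball by simp

lemma V_nonneg [simp]: "0 \<le> V r x"
  by (simp add: V_def)

lemma borel_measurable_V [measurable]: "V r \<in> borel_measurable borel"
proof -
  have [measurable]: "(\<lambda>x. emeasure M (cball x r)) \<in> borel_measurable borel"
    using sets_M sigma_finite_measure_axioms by (rule borel_measurable_emeasure_cball)
  show ?thesis
    unfolding V_def measure_def by measurable
qed

lemma V_mono: "cball x r \<subseteq> cball y s \<Longrightarrow> V r x \<le> V s y"
  using emeasure_mono[of "cball x r" "cball y s" M] by (simp add: sets_M emeasure_cball)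

lemma V_double:
  assumes "0 < r" "r \<le> 1"
  shows "V (2 * r) x \<le> Cd * V r x"
  using doubling[OF assms, of x] Cd_ge_1 by (simp add: emeasure_cball flip: ennreal_mult)

lemma V_double_near:
  assumes "dist x y \<le> r" "0 < r" "r \<le> 1"
  shows "V r y \<le> Cd * V r x"
  using V_mono[OF cball_subset_cball_double[OF assms(1)]] V_double[OF assms(2,3), of x] by simp

text \<open>The lower bound is only required almost everywhere: for the codimensional Hausdorff
  measure of a set it is available at the points of the set only.\<close>

definition codim_regular :: "real \<Rightarrow> real \<Rightarrow> real \<Rightarrow> 'a measure \<Rightarrow> bool" where
  "codim_regular t \<kappa> K H \<longleftrightarrow> sets H = sets borel \<and> 0 < \<kappa> \<and> 0 < K \<and>
     (AE x in H. \<forall>r\<in>{0<..1}. ennreal (\<kappa> * V r x * r powr - t) \<le> emeasure H (cball x r)) \<and>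
     (\<forall>x. \<forall>r\<in>{0<..1/2}. emeasure H (cball x r) \<le> ennreal (K * V r x * r powr - t))"

lemma codim_regularD:
  assumes "codim_regular t \<kappa> K H"
  shows "sets H = sets borel" "0 < \<kappa>" "0 < K"
    "AE x in H. \<forall>r\<in>{0<..1}. ennreal (\<kappa> * V r x * r powr - t) \<le> emeasure H (cball x r)"
    "0 < r \<Longrightarrow> r \<le> 1/2 \<Longrightarrow> emeasure H (cball x r) \<le> ennreal (K * V r x * r powr - t)"
  using assms by (auto simp: codim_regular_def)

lemma codim_regular_finite_cball:
  assumes "codim_regular t \<kappa> K H" "0 < r" "r \<le> 1/2"
  shows "emeasure H (cball x r) < \<infinity>"
  using codim_regularD(5)[OF assms, of x] by (simp add: le_less_trans)

lemma codim_regular_sigma_finite: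
  assumes "codim_regular t \<kappa> K H"
  shows "sigma_finite_measure H"
  using codim_regularD(1)[OF assms] codim_regular_finite_cball[OF assms, of "1/2"]
  by (intro sigma_finite_measure_locally_finite exI[of _ "1/2"]) auto

lemma codim_regular_integral_inverse_V_le:
  assumes H: "codim_regular t \<kappa> K H" and r: "0 < r" "r \<le> 1/2"
  shows "(\<integral>\<^sup>+x. ennreal (1 / V r x ^ Suc n) * indicator (cball x r) y \<partial>H)
    \<le> ennreal (Cd ^ Suc n * K * r powr - t) * ennreal (1 / V r y ^ n)"
proof -
  have V: "0 < V r x" for x
    using r by (intro V_pos)
  have "1 / V r x ^ Suc n \<le> Cd ^ Suc n / V r y ^ Suc n" if "dist x y \<le> r" for x
  proof -
    have "V r y ^ Suc n \<le> (Cd * V r x) ^ Suc n"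
      using that r by (intro power_mono V_double_near) auto
    then show ?thesis
      using V[of x] V[of y] by (simp add: divide_simps power_mult_distrib mult.commute del: power_Suc)
  qed
  then have "(\<integral>\<^sup>+x. ennreal (1 / V r x ^ Suc n) * indicator (cball x r) y \<partial>H)
      \<le> (\<integral>\<^sup>+x. ennreal (Cd ^ Suc n / V r y ^ Suc n) * indicator (cball y r) x \<partial>H)"
    by (intro nn_integral_mono) (auto simp: dist_commute intro!: ennreal_leI split: split_indicator)
  also have "\<dots> = ennreal (Cd ^ Suc n / V r y ^ Suc n) * emeasure H (cball y r)"
    by (simp add: nn_integral_cmult_indicator codim_regularD(1)[OF H])
  also have "\<dots> \<le> ennreal (Cd ^ Suc n / V r y ^ Suc n) * ennreal (K * V r y * r powr - t)"
    by (intro mult_left_mono codim_regularD(5)[OF H] r) auto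
  also have "\<dots> = ennreal (Cd ^ Suc n * K * r powr - t) * ennreal (1 / V r y ^ n)"
    using codim_regularD(3)[OF H] Cd_ge_1 V[of y] by (simp add: field_simps flip: ennreal_mult)
  finally show ?thesis .
qed

lemma codim_regular_ball_integrals_le:
  assumes H: "codim_regular t \<kappa> K H" and r: "0 < r" "r \<le> 1/2"
    and "sigma_finite_measure N"
    and [measurable]: "\<phi> \<in> borel_measurable N" "F \<in> borel_measurable N"
  shows "(\<integral>\<^sup>+x. ennreal (1 / V r x ^ Suc n) * (\<integral>\<^sup>+w. F w * indicator (cball x r) (\<phi> w) \<partial>N) \<partial>H)
    \<le> ennreal (Cd ^ Suc n * K * r powr - t) * (\<integral>\<^sup>+w. ennreal (1 / V r (\<phi> w) ^ n) * F w \<partial>N)"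
proof -
  interpret H: sigma_finite_measure H by (rule codim_regular_sigma_finite[OF H])
  interpret N: sigma_finite_measure N by fact
  interpret pair_sigma_finite H N ..
  note [measurable_cong] = codim_regularD(1)[OF H]
  let ?q = "\<lambda>x. ennreal (1 / V r x ^ Suc n)"
  have "(\<integral>\<^sup>+x. ?q x * (\<integral>\<^sup>+w. F w * indicator (cball x r) (\<phi> w) \<partial>N) \<partial>H)
      = (\<integral>\<^sup>+x. \<integral>\<^sup>+w. F w * (?q x * indicator (cball x r) (\<phi> w)) \<partial>N \<partial>H)"
    by (subst nn_integral_cmult[symmetric]) (auto simp: ac_simps)
  also have "\<dots> = (\<integral>\<^sup>+w. \<integral>\<^sup>+x. F w * (?q x * indicator (cball x r) (\<phi> w)) \<partial>H \<partial>N)"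
    by (rule Fubini'[symmetric]) measurable
  also have "\<dots> = (\<integral>\<^sup>+w. F w * (\<integral>\<^sup>+x. ?q x * indicator (cball x r) (\<phi> w) \<partial>H) \<partial>N)"
    by (intro nn_integral_cong nn_integral_cmult) measurable
  also have "\<dots> \<le> (\<integral>\<^sup>+w. F w * (ennreal (Cd ^ Suc n * K * r powr - t) * ennreal (1 / V r (\<phi> w) ^ n)) \<partial>N)"
    by (intro nn_integral_mono mult_left_mono codim_regular_integral_inverse_V_le[OF H] r) simp
  also have "\<dots> = ennreal (Cd ^ Suc n * K * r powr - t) * (\<integral>\<^sup>+w. ennreal (1 / V r (\<phi> w) ^ n) * F w \<partial>N)"
    by (subst nn_integral_cmult[symmetric]) (auto simp: ac_simps)
  finally show ?thesis .
qed

lemma inverse_V_le_weight: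
  assumes "dist y z \<le> (1/2) ^ n"
  shows "ennreal (1 / V ((1/2) ^ Suc n) y) \<le> ennreal (Cd\<^sup>2) * weight M n y z"
proof -
  define r :: real where "r = (1/2) ^ Suc n"
  have r: "0 < r" "2 * r \<le> 1" "(1/2) ^ n = 2 * r"
    using power_le_one[of "1/2::real" n] by (auto simp: r_def)
  have V: "0 < V r y" "0 < V (2 * r) y" "0 < V (2 * r) z"
    using r by (auto intro!: V_pos)
  have V_y: "V (2 * r) y \<le> Cd * V r y"
    using r by (intro V_double) auto
  have "V (2 * r) z \<le> Cd * V (2 * r) y"
    using r assms by (intro V_double_near) auto
  then have "V (2 * r) y * V (2 * r) z \<le> V (2 * r) y * (Cd * V (2 * r) y)"
    by (intro mult_left_mono) auto
  also have "\<dots> = Cd * (V (2 * r) y)\<^sup>2"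
    by (simp add: power2_eq_square)
  also have "\<dots> \<le> Cd\<^sup>2 * (Cd * V r y)\<^sup>2"
    using V_y Cd_ge_1 by (intro mult_mono power_mono self_le_power) auto
  also have "\<dots> = (Cd\<^sup>2 * V r y)\<^sup>2"
    by (simp add: power_mult_distrib power2_eq_square)
  finally have "sqrt (V (2 * r) y * V (2 * r) z) \<le> Cd\<^sup>2 * V r y"
    using V Cd_ge_1 by (intro real_le_lsqrt) auto
  then have "1 / V r y \<le> Cd\<^sup>2 * (1 / sqrt (V (2 * r) y * V (2 * r) z))"
    using V by (simp add: field_simps)
  then have "ennreal (1 / V r y) \<le> ennreal (Cd\<^sup>2) * ennreal (1 / sqrt (V (2 * r) y * V (2 * r) z))"
    using V by (simp add: ennreal_mult[symmetric] ennreal_leI)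
  also have "ennreal (1 / sqrt (V (2 * r) y * V (2 * r) z)) = weight M n y z"
    using V unfolding weight_def r(3) emeasure_cball
    by (simp add: epow_ennreal powr_half_sqrt inverse_ennreal inverse_eq_divide flip: ennreal_mult)
  finally show ?thesis
    unfolding r_def .
qed

end

definition gluing_integral ::
    "'a::metric_space measure \<Rightarrow> real \<Rightarrow> nat \<Rightarrow> 'a measure \<Rightarrow> 'a measure \<Rightarrow> ('a \<Rightarrow> real) \<Rightarrow> ennreal" where
  "gluing_integral M p k H H' f = (\<integral>\<^sup>+z. \<integral>\<^sup>+y. indicator {(y,z). dist y z \<le> (1/2)^k} (y,z) *
     weight M k y z * epow (ennreal \<bar>f y - f z\<bar>) p \<partial>H \<partial>H')"

definition close_difference :: "real \<Rightarrow> real \<Rightarrow> ('a::metric_space \<Rightarrow> real) \<Rightarrow> 'a \<times> 'a \<Rightarrow> ennreal" where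
  "close_difference p r f w =
    (if dist (fst w) (snd w) \<le> r then epow (ennreal \<bar>f (fst w) - f (snd w)\<bar>) p else 0)"

lemma borel_measurable_close_difference [measurable]:
  fixes f :: "'a::{metric_space,second_countable_topology} \<Rightarrow> real"
  assumes [measurable_cong]: "sets H = sets borel" "sets H' = sets borel"
    and [measurable]: "f \<in> borel_measurable borel"
  shows "close_difference p r f \<in> borel_measurable (H \<Otimes>\<^sub>M H')"
  unfolding close_difference_def by measurable

lemma pair_energy_cball_le:
  fixes H H' :: "'a::{metric_space,second_countable_topology} measure"
  assumes "sigma_finite_measure H'" and [measurable_cong]: "sets H = sets borel" "sets H' = sets borel"
    and [measurable]: "f \<in> borel_measurable borel"
  shows "pair_energy p H H' f (cball x r)
    \<le> (\<integral>\<^sup>+w. close_difference p (2 * r) f w * indicator (cball x r) (fst w) \<partial>(H \<Otimes>\<^sub>M H'))"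
proof -
  interpret H': sigma_finite_measure H' by fact
  have "indicator (cball x r) y * (epow (ennreal \<bar>f z - f y\<bar>) p * indicator (cball x r) z)
      \<le> close_difference p (2 * r) f (y, z) * indicator (cball x r) y" for y z
    using dist_triangle3[of y z x]
    by (auto simp: close_difference_def abs_minus_commute split: split_indicator)
  then have "(\<integral>\<^sup>+y. \<integral>\<^sup>+z. indicator (cball x r) y *
        (epow (ennreal \<bar>f z - f y\<bar>) p * indicator (cball x r) z) \<partial>H' \<partial>H)
      \<le> (\<integral>\<^sup>+y. \<integral>\<^sup>+z. close_difference p (2 * r) f (y, z) * indicator (cball x r) (fst (y, z)) \<partial>H' \<partial>H)"
    by (intro nn_integral_mono) simp
  also have "\<dots> = (\<integral>\<^sup>+w. close_difference p (2 * r) f w * indicator (cball x r) (fst w) \<partial>(H \<Otimes>\<^sub>M H'))"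
    by (rule H'.nn_integral_fst) measurable
  finally show ?thesis
    by (simp add: pair_energy_def nn_integral_cmult mult.commute)
qed

context doubling_measure
begin

lemma close_difference_integral_le:
  assumes "sigma_finite_measure H" "sigma_finite_measure H'"
    and [measurable_cong]: "sets H = sets borel" "sets H' = sets borel"
    and [measurable]: "f \<in> borel_measurable borel" and r: "r = (1/2) ^ Suc k"
  shows "(\<integral>\<^sup>+w. ennreal (1 / V r (fst w)) * close_difference p (2 * r) f w \<partial>(H \<Otimes>\<^sub>M H'))
    \<le> ennreal (Cd\<^sup>2) * gluing_integral M p k H H' f"
proof -
  interpret H: sigma_finite_measure H by fact
  interpret H': sigma_finite_measure H' by fact
  interpret pair_sigma_finite H H' ..
  have r2: "(1/2) ^ k = 2 * r"
    by (simp add: r)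
  have "(\<integral>\<^sup>+w. ennreal (1 / V r (fst w)) * close_difference p (2 * r) f w \<partial>(H \<Otimes>\<^sub>M H'))
      = (\<integral>\<^sup>+z. \<integral>\<^sup>+y. ennreal (1 / V r y) * close_difference p (2 * r) f (y, z) \<partial>H \<partial>H')"
    by (subst nn_integral_snd[symmetric]) simp_all
  also have "\<dots> \<le> (\<integral>\<^sup>+z. \<integral>\<^sup>+y. ennreal (Cd\<^sup>2) * (indicator {(y,z). dist y z \<le> (1/2)^k} (y,z) *
      weight M k y z * epow (ennreal \<bar>f y - f z\<bar>) p) \<partial>H \<partial>H')"
    using inverse_V_le_weight[of _ _ k, folded r] unfolding r2
    by (intro nn_integral_mono) (auto simp: close_difference_def mult.assoc[symmetric] intro!: mult_right_mono)
  also have "\<dots> = ennreal (Cd\<^sup>2) * gluing_integral M p k H H' f"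
    unfolding gluing_integral_def weight_def emeasure_cball
    by (subst nn_integral_cmult[symmetric], measurable) (intro nn_integral_cong nn_integral_cmult, measurable)
  finally show ?thesis .
qed

lemma codim_regular_pair_energy_le:
  assumes H: "codim_regular t \<kappa> K H" and H': "sigma_finite_measure H'" "sets H' = sets borel"
    and f: "f \<in> borel_measurable borel" and r: "r = (1/2) ^ Suc k"
  shows "(\<integral>\<^sup>+x. ennreal (1 / (V r x)\<^sup>2) * pair_energy p H H' f (cball x r) \<partial>H)
    \<le> ennreal (Cd ^ 4 * K * r powr - t) * gluing_integral M p k H H' f"
proof -
  interpret H: sigma_finite_measure H by (rule codim_regular_sigma_finite[OF H])
  interpret H': sigma_finite_measure H' by fact
  interpret pair_sigma_finite H H' ..
  note [measurable_cong] = codim_regularD(1)[OF H] H'(2) and [measurable] = f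
  have r0: "0 < r" "r \<le> 1/2"
    using power_le_one[of "1/2::real" k] by (auto simp: r)
  let ?F = "close_difference p (2 * r) f"
  have "(\<integral>\<^sup>+x. ennreal (1 / (V r x)\<^sup>2) * pair_energy p H H' f (cball x r) \<partial>H)
      \<le> (\<integral>\<^sup>+x. ennreal (1 / V r x ^ Suc 1) * (\<integral>\<^sup>+w. ?F w * indicator (cball x r) (fst w) \<partial>(H \<Otimes>\<^sub>M H')) \<partial>H)"
    using pair_energy_cball_le[OF H'(1) codim_regularD(1)[OF H] H'(2) f]
    by (intro nn_integral_mono mult_mono) (simp_all add: power2_eq_square)
  also have "\<dots> \<le> ennreal (Cd ^ Suc 1 * K * r powr - t) * (\<integral>\<^sup>+w. ennreal (1 / V r (fst w) ^ 1) * ?F w \<partial>(H \<Otimes>\<^sub>M H'))"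
    using sigma_finite_measure_axioms by (intro codim_regular_ball_integrals_le[OF H] r0) measurable
  also have "\<dots> \<le> ennreal (Cd ^ Suc 1 * K * r powr - t) * (ennreal (Cd\<^sup>2) * gluing_integral M p k H H' f)"
    using close_difference_integral_le[OF codim_regular_sigma_finite[OF H] H'(1) codim_regularD(1)[OF H] H'(2) f r]
    by (intro mult_left_mono) simp_all
  also have "\<dots> = ennreal (Cd ^ 4 * K * r powr - t) * gluing_integral M p k H H' f"
  proof -
    have const: "Cd ^ 4 * K * r powr - t = (Cd ^ Suc 1 * K * r powr - t) * Cd\<^sup>2"
      by (simp add: power2_eq_square power4_eq_xxxx)
    have "0 \<le> Cd ^ Suc 1 * K * r powr - t"
      using codim_regularD(3)[OF H] Cd_ge_1 by simp
    then show ?thesis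
      unfolding const by (subst ennreal_mult) (auto simp only: zero_le_power2 mult.assoc)
  qed
  finally show ?thesis .
qed

end

subsection \<open>Oscillation energies of a finite family of regular measures\<close>

definition Lp_energy :: "real \<Rightarrow> 'a measure \<Rightarrow> ('a \<Rightarrow> real) \<Rightarrow> ennreal" where
  "Lp_energy p H f = (\<integral>\<^sup>+x. epow (ennreal \<bar>f x\<bar>) p \<partial>H)"

definition osc_level ::
    "real \<Rightarrow> real \<Rightarrow> 'a::metric_space measure \<Rightarrow> 'a measure \<Rightarrow> ('a \<Rightarrow> real) \<Rightarrow> nat \<Rightarrow> ennreal" where
  "osc_level s p m H f k =
    ennreal (2 powr (real k * s)) * (\<integral>\<^sup>+x. epow (Eosc m f (cball x ((1/2)^k))) p \<partial>H)"

definition gluing_level ::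
    "'a::metric_space measure \<Rightarrow> real \<Rightarrow> real \<Rightarrow> 'a measure \<Rightarrow> 'a measure \<Rightarrow> ('a \<Rightarrow> real) \<Rightarrow> nat \<Rightarrow> ennreal" where
  "gluing_level M s p H H' f k = ennreal (2 powr (real k * s)) * gluing_integral M p k H H' f"

lemma half_power_powr: "((1/2)^k) powr - s = 2 powr (real k * s)"
  by (simp add: powr_realpow[symmetric] powr_powr powr_minus powr_divide)

lemma half_power_le_half: "1 \<le> k \<Longrightarrow> (1/2::real) ^ k \<le> 1/2"
  using power_decreasing[of 1 k "1/2::real"] by simp

lemma divide_ennreal_le:
  assumes "0 \<le> a" "0 < b" "ennreal b \<le> x"
  shows "ennreal a / x \<le> ennreal (a / b)"
proof (rule divide_le_posI_ennreal)
  show "0 < x"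
    using assms by (auto intro: less_le_trans[of _ "ennreal b"])
  have "ennreal a = ennreal b * ennreal (a / b)"
    using assms by (simp flip: ennreal_mult)
  also have "\<dots> \<le> x * ennreal (a / b)"
    by (intro mult_right_mono assms) simp
  finally show "ennreal a \<le> x * ennreal (a / b)" .
qed

locale regular_family = doubling_measure M Cd
  for M :: "'a::{metric_space,second_countable_topology} measure" and Cd :: real +
  fixes I :: "'i set" and H :: "'i \<Rightarrow> 'a measure" and t \<kappa> K :: "'i \<Rightarrow> real" and p \<theta> :: real
  assumes finite_I: "finite I"
    and regular_H: "i \<in> I \<Longrightarrow> codim_regular (t i) (\<kappa> i) (K i) (H i)"
    and t_nonneg: "i \<in> I \<Longrightarrow> 0 \<le> t i"
    and p_ge_1: "1 \<le> p" and \<theta>_le_p: "\<theta> \<le> p"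
begin

definition level_coeff :: "nat \<Rightarrow> 'i \<Rightarrow> ennreal" where
  "level_coeff k i = ennreal (2 powr (real k * (\<theta> - t i)))"

definition m :: "nat \<Rightarrow> 'a measure" where
  "m k = sum_measure I (level_coeff k) H"

lemmas sets_H = codim_regularD(1)[OF regular_H]
  and \<kappa>_pos = codim_regularD(2)[OF regular_H]
  and K_pos = codim_regularD(3)[OF regular_H]
  and sigma_finite_H = codim_regular_sigma_finite[OF regular_H]

lemma level_coeff_pos: "0 < level_coeff k i"
  by (simp add: level_coeff_def)

lemma sets_m: "sets (m k) = sets borel"
  by (simp add: m_def sets_sum_measure)

lemma emeasure_m_finite_cball:
  assumes "0 < r" "r \<le> 1/2"
  shows "emeasure (m k) (cball x r) < \<infinity>"
  using codim_regular_finite_cball[OF regular_H assms] finite_I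
  by (simp add: m_def emeasure_sum_measure sets_H level_coeff_def ennreal_mult_less_top)

lemma sigma_finite_m: "sigma_finite_measure (m k)"
  using sets_m emeasure_m_finite_cball[of "1/2"]
  by (intro sigma_finite_measure_locally_finite exI[of _ "1/2"]) auto

lemma osc_level_m_le:
  assumes f: "f \<in> borel_measurable borel"
  shows "osc_level (\<theta> - p) p (m k) (m k) f k \<le> (\<Sum>i\<in>I. osc_level (p - t i) p (m k) (H i) f k)"
proof -
  let ?E = "\<lambda>x. epow (Eosc (m k) f (cball x ((1/2)^k))) p"
  have "?E \<in> borel_measurable borel"
    using borel_measurable_Eosc_cball[OF sets_m sigma_finite_m f] by measurable
  then have "(\<integral>\<^sup>+x. ?E x \<partial>m k) = (\<Sum>i\<in>I. level_coeff k i * (\<integral>\<^sup>+x. ?E x \<partial>H i))"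
    unfolding m_def by (intro nn_integral_sum_measure sets_H)
  then have "osc_level (\<theta> - p) p (m k) (m k) f k
      = (\<Sum>i\<in>I. ennreal (2 powr (real k * (\<theta> - p))) * level_coeff k i * (\<integral>\<^sup>+x. ?E x \<partial>H i))"
    by (simp add: osc_level_def sum_distrib_left mult.assoc)
  also have "\<dots> \<le> (\<Sum>i\<in>I. ennreal (2 powr (real k * (p - t i))) * (\<integral>\<^sup>+x. ?E x \<partial>H i))"
  proof (intro sum_mono mult_right_mono)
    fix i
    have "real k * (\<theta> - p) + real k * (\<theta> - t i) \<le> real k * (p - t i)"
      unfolding distrib_left[symmetric] using \<theta>_le_p by (intro mult_left_mono) auto
    then show "ennreal (2 powr (real k * (\<theta> - p))) * level_coeff k i \<le> ennreal (2 powr (real k * (p - t i)))"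
      by (simp add: level_coeff_def flip: ennreal_mult powr_add)
  qed simp
  finally show ?thesis
    by (simp add: osc_level_def)
qed

lemma AE_emeasure_H_cball_ge:
  assumes "i \<in> I"
  shows "AE x in H i. ennreal (\<kappa> i * V ((1/2)^k) x * 2 powr (real k * t i)) \<le> emeasure (H i) (cball x ((1/2)^k))"
  using codim_regularD(4)[OF regular_H[OF assms]]
proof eventually_elim
  case (elim x)
  then show ?case
    using half_power_powr[of k "t i"] by (auto dest!: bspec[of _ _ "(1/2)^k"] simp: power_le_one)
qed

lemma inverse_emeasure_H_le:
  assumes i: "i \<in> I" and r: "r = (1/2) ^ k"
    and lower: "ennreal (\<kappa> i * V r x * 2 powr (real k * t i)) \<le> emeasure (H i) (cball x r)"
  shows "inverse (emeasure (H i) (cball x r)) \<le> ennreal (2 powr - (real k * t i) / (\<kappa> i * V r x))"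
proof -
  have "ennreal 1 / emeasure (H i) (cball x r) \<le> ennreal (1 / (\<kappa> i * V r x * 2 powr (real k * t i)))"
    using \<kappa>_pos[OF i] V_pos[of r x] r lower by (intro divide_ennreal_le) auto
  then show ?thesis
    by (simp add: powr_minus divide_ennreal_def field_simps)
qed

lemma level_coeff_div_emeasure_m_le:
  assumes i: "i \<in> I" and r: "r = (1/2) ^ k"
    and lower: "ennreal (\<kappa> i * V r x * 2 powr (real k * t i)) \<le> emeasure (H i) (cball x r)"
  shows "level_coeff k j / emeasure (m k) (cball x r) \<le> ennreal (2 powr - (real k * t j) / (\<kappa> i * V r x))"
proof -
  let ?a = "2 powr (real k * (\<theta> - t i))" and ?b = "\<kappa> i * V r x * 2 powr (real k * t i)"
  have "ennreal (?a * ?b) \<le> level_coeff k i * emeasure (H i) (cball x r)"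
    using lower by (simp add: level_coeff_def ennreal_mult' mult_left_mono)
  also have "\<dots> \<le> emeasure (m k) (cball x r)"
    unfolding m_def by (rule mult_emeasure_le_emeasure_sum_measure) (use finite_I i sets_H in auto)
  finally have "level_coeff k j / emeasure (m k) (cball x r) \<le> ennreal (2 powr (real k * (\<theta> - t j)) / (?a * ?b))"
    unfolding level_coeff_def using \<kappa>_pos[OF i] V_pos[of r x] r by (intro divide_ennreal_le) auto
  also have "?a * ?b = 2 powr (real k * \<theta>) * (\<kappa> i * V r x)"
    by (simp add: algebra_simps flip: powr_add)
  also have "2 powr (real k * (\<theta> - t j)) = 2 powr (real k * \<theta>) * 2 powr - (real k * t j)"
    by (simp add: algebra_simps flip: powr_add)
  finally show ?thesis
    by simp
qed

lemma epow_Eosc_m_le_Lp_integrals: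
  assumes i: "i \<in> I" and f [measurable]: "f \<in> borel_measurable borel" and r: "r = (1/2) ^ k"
    and lower: "ennreal (\<kappa> i * V r x * 2 powr (real k * t i)) \<le> emeasure (H i) (cball x r)"
  shows "epow (Eosc (m k) f (cball x r)) p
    \<le> (\<Sum>j\<in>I. ennreal (1 / \<kappa> i) * (ennreal (1 / V r x) * (\<integral>\<^sup>+y\<in>cball x r. epow (ennreal \<bar>f y\<bar>) p \<partial>H j)))"
proof -
  let ?B = "cball x r" and ?e = "\<lambda>y. epow (ennreal \<bar>f y\<bar>) p"
  note [measurable_cong] = sets_m
  have "epow (Eosc (m k) f ?B) p \<le> epow (Av (m k) ?B (\<lambda>y. ennreal \<bar>f y\<bar>)) p"
    using Eosc_le_Av[of "m k" f ?B 0] p_ge_1 by (intro epow_mono) auto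
  also have "\<dots> \<le> Av (m k) ?B ?e"
    using p_ge_1 by (intro epow_Av_le) (auto simp: sets_m)
  also have "\<dots> = (\<Sum>j\<in>I. level_coeff k j / emeasure (m k) ?B * (\<integral>\<^sup>+y\<in>?B. ?e y \<partial>H j))"
    unfolding m_def by (intro Av_sum_measure sets_H) auto
  also have "\<dots> \<le> (\<Sum>j\<in>I. ennreal (1 / \<kappa> i) * (ennreal (1 / V r x) * (\<integral>\<^sup>+y\<in>?B. ?e y \<partial>H j)))"
    unfolding mult.assoc[symmetric]
  proof (intro sum_mono mult_right_mono)
    fix j assume j: "j \<in> I"
    have "level_coeff k j / emeasure (m k) ?B \<le> ennreal (2 powr - (real k * t j) / (\<kappa> i * V r x))"
      by (rule level_coeff_div_emeasure_m_le[OF i r lower])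
    also have "\<dots> \<le> ennreal (1 / \<kappa> i * (1 / V r x))"
      using t_nonneg[OF j] \<kappa>_pos[OF i] powr_mono[of "- (real k * t j)" 0 2]
      by (intro ennreal_leI) (simp add: divide_right_mono)
    finally show "level_coeff k j / emeasure (m k) ?B \<le> ennreal (1 / \<kappa> i) * ennreal (1 / V r x)"
      using \<kappa>_pos[OF i] by (simp flip: ennreal_mult)
  qed simp
  finally show ?thesis .
qed

lemma nn_integral_epow_Eosc_m_le_Lp_energy:
  assumes i: "i \<in> I" and f [measurable]: "f \<in> borel_measurable borel" and r: "r = (1/2) ^ k" "r \<le> 1/2"
  shows "(\<integral>\<^sup>+x. epow (Eosc (m k) f (cball x r)) p \<partial>H i)
    \<le> (\<Sum>j\<in>I. ennreal (1 / \<kappa> i) * (ennreal (Cd * K i * r powr - t i) * Lp_energy p (H j) f))"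
proof -
  have r0: "0 < r"
    by (simp add: r)
  note [measurable_cong] = sets_H[OF i]
  let ?e = "\<lambda>y. epow (ennreal \<bar>f y\<bar>) p"
  let ?L = "\<lambda>j x. ennreal (1 / V r x) * (\<integral>\<^sup>+y\<in>cball x r. ?e y \<partial>H j)"
  have L: "?L j \<in> borel_measurable borel" if "j \<in> I" for j
  proof -
    interpret sigma_finite_measure "H j" using that by (rule sigma_finite_H)
    note [measurable_cong] = sets_H[OF that]
    show ?thesis by measurable
  qed
  have "AE x in H i. epow (Eosc (m k) f (cball x r)) p \<le> (\<Sum>j\<in>I. ennreal (1 / \<kappa> i) * ?L j x)"
    using AE_emeasure_H_cball_ge[OF i, of k, folded r(1)]
    by eventually_elim (rule epow_Eosc_m_le_Lp_integrals[OF i f r(1)])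
  then have "(\<integral>\<^sup>+x. epow (Eosc (m k) f (cball x r)) p \<partial>H i) \<le> (\<integral>\<^sup>+x. (\<Sum>j\<in>I. ennreal (1 / \<kappa> i) * ?L j x) \<partial>H i)"
    by (rule nn_integral_mono_AE)
  also have "\<dots> = (\<Sum>j\<in>I. ennreal (1 / \<kappa> i) * (\<integral>\<^sup>+x. ?L j x \<partial>H i))"
    using L by (simp add: nn_integral_sum nn_integral_cmult)
  also have "\<dots> \<le> (\<Sum>j\<in>I. ennreal (1 / \<kappa> i) * (ennreal (Cd * K i * r powr - t i) * Lp_energy p (H j) f))"
  proof (intro sum_mono mult_left_mono)
    fix j assume j: "j \<in> I"
    note [measurable_cong] = sets_H[OF j]
    have "(\<integral>\<^sup>+x. ennreal (1 / V r x ^ Suc 0) * (\<integral>\<^sup>+y\<in>cball x r. ?e y \<partial>H j) \<partial>H i)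
        \<le> ennreal (Cd ^ Suc 0 * K i * r powr - t i) * (\<integral>\<^sup>+y. ennreal (1 / V r y ^ 0) * ?e y \<partial>H j)"
      by (intro codim_regular_ball_integrals_le[OF regular_H[OF i]] r0 r(2) sigma_finite_H[OF j]) measurable
    then show "(\<integral>\<^sup>+x. ?L j x \<partial>H i) \<le> ennreal (Cd * K i * r powr - t i) * Lp_energy p (H j) f"
      by (simp add: Lp_energy_def)
  qed auto
  finally show ?thesis .
qed

lemma osc_level_le_Lp_energy:
  assumes i: "i \<in> I" and f: "f \<in> borel_measurable borel" and k: "1 \<le> k"
  shows "osc_level (p - t i) p (m k) (H i) f k
    \<le> ennreal (Cd * K i / \<kappa> i * 2 powr (real k * p)) * (\<Sum>j\<in>I. Lp_energy p (H j) f)"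
proof -
  let ?w = "2 powr (real k * (p - t i))" and ?c = "Cd * K i * ((1/2) ^ k) powr - t i"
  have "osc_level (p - t i) p (m k) (H i) f k
      \<le> ennreal ?w * (\<Sum>j\<in>I. ennreal (1 / \<kappa> i) * (ennreal ?c * Lp_energy p (H j) f))"
    unfolding osc_level_def
    by (intro mult_left_mono nn_integral_epow_Eosc_m_le_Lp_energy i f half_power_le_half k) simp_all
  also have "\<dots> = ennreal (?w * (1 / \<kappa> i) * ?c) * (\<Sum>j\<in>I. Lp_energy p (H j) f)"
    using \<kappa>_pos[OF i] K_pos[OF i] Cd_ge_1
    by (simp add: sum_distrib_left mult.assoc[symmetric] ennreal_mult[symmetric])
  also have "?w * (1 / \<kappa> i) * ?c = Cd * K i / \<kappa> i * 2 powr (real k * p)"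
    unfolding half_power_powr by (simp add: algebra_simps flip: powr_add)
  finally show ?thesis .
qed

lemma epow_Eosc_m_le_pair_energy:
  assumes i: "i \<in> I" and f: "f \<in> borel_measurable borel" and r: "r = (1/2) ^ k" "r \<le> 1/2"
    and lower: "ennreal (\<kappa> i * V r x * 2 powr (real k * t i)) \<le> emeasure (H i) (cball x r)"
  shows "epow (Eosc (m k) f (cball x r)) p \<le> ennreal (real (card I) powr p) *
    (ennreal (2 powr p) * epow (Eosc (H i) f (cball x r)) p +
      (\<Sum>j\<in>I - {i}. ennreal (2 powr - (real k * (t i + t j)) / (\<kappa> i)\<^sup>2) *
        (ennreal (1 / (V r x)\<^sup>2) * pair_energy p (H i) (H j) f (cball x r))))"
proof -
  let ?B = "cball x r" and ?q = "\<lambda>j. ennreal (2 powr - (real k * t j) / (\<kappa> i * V r x))"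
  have V: "0 < V r x"
    using r by (intro V_pos) simp
  have coeffs: "?q i * ?q j = ennreal (2 powr - (real k * (t i + t j)) / (\<kappa> i)\<^sup>2) * ennreal (1 / (V r x)\<^sup>2)" for j
  proof -
    have "2 powr - (real k * t i) * 2 powr - (real k * t j) = 2 powr - (real k * (t i + t j))"
      by (simp add: algebra_simps flip: powr_add)
    then show ?thesis
      using \<kappa>_pos[OF i] V by (simp add: power2_eq_square ac_simps flip: ennreal_mult)
  qed
  have "0 < ennreal (\<kappa> i * V r x * 2 powr (real k * t i))"
    using V \<kappa>_pos[OF i] by simp
  then have "0 < emeasure (H i) ?B"
    using lower by (rule less_le_trans)
  moreover have "emeasure (H i) ?B < \<infinity>"
    using r by (intro codim_regular_finite_cball[OF regular_H[OF i]]) auto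
  ultimately have "epow (Eosc (m k) f ?B) p \<le> ennreal (real (card I) powr p) *
      (ennreal (2 powr p) * epow (Eosc (H i) f ?B) p +
        (\<Sum>j\<in>I - {i}. inverse (emeasure (H i) ?B) * (level_coeff k j / emeasure (m k) ?B) *
          pair_energy p (H i) (H j) f ?B))"
    unfolding m_def using finite_I i sets_H sigma_finite_H level_coeff_pos f p_ge_1
    by (intro epow_Eosc_sum_measure_le) auto
  also have "\<dots> \<le> ennreal (real (card I) powr p) *
      (ennreal (2 powr p) * epow (Eosc (H i) f ?B) p +
        (\<Sum>j\<in>I - {i}. ?q i * ?q j * pair_energy p (H i) (H j) f ?B))"
    by (intro mult_left_mono add_left_mono sum_mono mult_right_mono mult_mono
        inverse_emeasure_H_le[OF i r(1) lower] level_coeff_div_emeasure_m_le[OF i r(1) lower]) simp_all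
  finally show ?thesis
    by (simp only: coeffs mult.assoc)
qed

lemma pair_energy_integral_le:
  assumes i: "i \<in> I" and j: "j \<in> I" and f: "f \<in> borel_measurable borel" and r: "r = (1/2) ^ Suc k"
  shows "ennreal (2 powr - (real (Suc k) * (t i + t j)) / (\<kappa> i)\<^sup>2) *
      (\<integral>\<^sup>+x. ennreal (1 / (V r x)\<^sup>2) * pair_energy p (H i) (H j) f (cball x r) \<partial>H i)
    \<le> ennreal (Cd ^ 4 * K i / (\<kappa> i)\<^sup>2 * 2 powr - (real (Suc k) * t j)) * gluing_integral M p k (H i) (H j) f"
    (is "ennreal ?b * ?J \<le> _ * ?G")
proof -
  have "ennreal ?b * ?J \<le> ennreal ?b * (ennreal (Cd ^ 4 * K i * r powr - t i) * ?G)"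
    by (intro mult_left_mono codim_regular_pair_energy_le[OF regular_H[OF i]] sigma_finite_H sets_H j f r) simp
  also have "\<dots> = ennreal (?b * (Cd ^ 4 * K i * r powr - t i)) * ?G"
    by (simp only: ennreal_mult' mult.assoc powr_ge_zero divide_nonneg_nonneg zero_le_power2)
  also have "?b * (Cd ^ 4 * K i * r powr - t i) = Cd ^ 4 * K i / (\<kappa> i)\<^sup>2 * 2 powr - (real (Suc k) * t j)"
    unfolding r half_power_powr by (simp add: algebra_simps flip: powr_add)
  finally show ?thesis .
qed

lemma nn_integral_epow_Eosc_m_le_gluing_integral:
  assumes i: "i \<in> I" and f [measurable]: "f \<in> borel_measurable borel" and r: "r = (1/2) ^ Suc k"
  shows "(\<integral>\<^sup>+x. epow (Eosc (m (Suc k)) f (cball x r)) p \<partial>H i) \<le> ennreal (real (card I) powr p) *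
    (ennreal (2 powr p) * (\<integral>\<^sup>+x. epow (Eosc (H i) f (cball x r)) p \<partial>H i) +
      (\<Sum>j\<in>I - {i}. ennreal (Cd ^ 4 * K i / (\<kappa> i)\<^sup>2 * 2 powr - (real (Suc k) * t j)) *
        gluing_integral M p k (H i) (H j) f))"
proof -
  have r_le: "r \<le> 1/2"
    unfolding r by (rule half_power_le_half) simp
  let ?n = "real (card I) powr p" and ?b = "\<lambda>j. 2 powr - (real (Suc k) * (t i + t j)) / (\<kappa> i)\<^sup>2"
  let ?E = "\<lambda>x. epow (Eosc (H i) f (cball x r)) p"
  let ?D = "\<lambda>j x. ennreal (1 / (V r x)\<^sup>2) * pair_energy p (H i) (H j) f (cball x r)"
  note [measurable_cong] = sets_H[OF i]
  have [measurable]: "?E \<in> borel_measurable borel"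
    using borel_measurable_Eosc_cball[OF sets_H[OF i] sigma_finite_H[OF i] f] by measurable
  have [measurable]: "?D j \<in> borel_measurable borel" if j: "j \<in> I" for j
    using borel_measurable_pair_energy_cball[OF sets_H[OF i] sets_H[OF j] sigma_finite_H[OF i] sigma_finite_H[OF j]]
    by measurable
  have D_sum: "(\<integral>\<^sup>+x. (\<Sum>j\<in>I - {i}. ennreal (?b j) * ?D j x) \<partial>H i)
      = (\<Sum>j\<in>I - {i}. ennreal (?b j) * (\<integral>\<^sup>+x. ?D j x \<partial>H i))"
    by (subst nn_integral_sum) (auto intro!: sum.cong nn_integral_cmult)
  have "AE x in H i. epow (Eosc (m (Suc k)) f (cball x r)) p
      \<le> ennreal ?n * (ennreal (2 powr p) * ?E x + (\<Sum>j\<in>I - {i}. ennreal (?b j) * ?D j x))"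
    using AE_emeasure_H_cball_ge[OF i, of "Suc k", folded r]
    by eventually_elim (rule epow_Eosc_m_le_pair_energy[OF i f r r_le])
  then have "(\<integral>\<^sup>+x. epow (Eosc (m (Suc k)) f (cball x r)) p \<partial>H i)
      \<le> (\<integral>\<^sup>+x. ennreal ?n * (ennreal (2 powr p) * ?E x + (\<Sum>j\<in>I - {i}. ennreal (?b j) * ?D j x)) \<partial>H i)"
    by (rule nn_integral_mono_AE)
  also have "\<dots> = ennreal ?n * (ennreal (2 powr p) * (\<integral>\<^sup>+x. ?E x \<partial>H i)
      + (\<Sum>j\<in>I - {i}. ennreal (?b j) * (\<integral>\<^sup>+x. ?D j x \<partial>H i)))"
    by (simp add: nn_integral_cmult nn_integral_add D_sum del: of_nat_Suc)
  finally show ?thesis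
    by (rule order_trans) (intro mult_left_mono add_left_mono sum_mono pair_energy_integral_le i f r; simp)
qed

lemma gluing_level_shift:
  assumes i: "i \<in> I" and j: "j \<in> I" and c: "0 \<le> c"
  shows "ennreal (2 powr (real (Suc k) * (p - t i))) *
      (ennreal (c * 2 powr - (real (Suc k) * t j)) * gluing_integral M p k (H i) (H j) f)
    \<le> ennreal (2 powr p) * (ennreal c * gluing_level M (p - t i - t j) p (H i) (H j) f k)"
    (is "ennreal ?w * (ennreal (c * ?v) * ?G) \<le> _")
proof -
  have "real (Suc k) * (p - t i) - real (Suc k) * t j \<le> p + real k * (p - t i - t j)"
    using t_nonneg[OF i] t_nonneg[OF j] by (simp add: algebra_simps)
  then have "?w * ?v \<le> 2 powr p * 2 powr (real k * (p - t i - t j))"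
    by (simp flip: powr_add)
  from mult_left_mono[OF this c]
  have "ennreal (?w * (c * ?v)) \<le> ennreal (2 powr p * (c * 2 powr (real k * (p - t i - t j))))"
    by (intro ennreal_leI) (simp only: ac_simps)
  then have "ennreal (?w * (c * ?v)) * ?G \<le> ennreal (2 powr p * (c * 2 powr (real k * (p - t i - t j)))) * ?G"
    by (rule mult_right_mono) simp
  then show ?thesis
    using c by (simp add: gluing_level_def ennreal_mult mult.assoc)
qed

lemma osc_level_Suc_le:
  assumes i: "i \<in> I" and f: "f \<in> borel_measurable borel"
  defines "c \<equiv> Cd ^ 4 * K i / (\<kappa> i)\<^sup>2"
  shows "osc_level (p - t i) p (m (Suc k)) (H i) f (Suc k)
    \<le> ennreal ((2 * real (card I)) powr p * (1 + c)) * (osc_level (p - t i) p (H i) (H i) f (Suc k) +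
      (\<Sum>j\<in>I - {i}. gluing_level M (p - t i - t j) p (H i) (H j) f k))"
proof -
  let ?w = "2 powr (real (Suc k) * (p - t i))" and ?n = "real (card I) powr p"
  let ?E = "osc_level (p - t i) p (H i) (H i) f (Suc k)" and ?G = "\<lambda>j. gluing_integral M p k (H i) (H j) f"
  let ?L = "\<lambda>j. gluing_level M (p - t i - t j) p (H i) (H j) f k"
  have c: "0 \<le> c"
    using K_pos[OF i] Cd_ge_1 by (simp add: c_def)
  have c_le: "ennreal c * u \<le> ennreal (1 + c) * u" "u \<le> ennreal (1 + c) * u" for u
    using c mult_right_mono[of 1 "ennreal (1 + c)" u] by (auto intro!: mult_right_mono ennreal_leI)
  have "osc_level (p - t i) p (m (Suc k)) (H i) f (Suc k) \<le> ennreal ?w * (ennreal ?n *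
      (ennreal (2 powr p) * (\<integral>\<^sup>+x. epow (Eosc (H i) f (cball x ((1/2)^Suc k))) p \<partial>H i) +
        (\<Sum>j\<in>I - {i}. ennreal (c * 2 powr - (real (Suc k) * t j)) * ?G j)))"
    unfolding osc_level_def c_def by (intro mult_left_mono nn_integral_epow_Eosc_m_le_gluing_integral i f) simp_all
  also have "\<dots> = ennreal ?n * (ennreal (2 powr p) * ?E +
        (\<Sum>j\<in>I - {i}. ennreal ?w * (ennreal (c * 2 powr - (real (Suc k) * t j)) * ?G j)))"
    by (simp only: osc_level_def distrib_left sum_distrib_left mult.left_commute)
  also have "\<dots> \<le> ennreal ?n * (ennreal (2 powr p) * ?E + (\<Sum>j\<in>I - {i}. ennreal (2 powr p) * (ennreal c * ?L j)))"
    using gluing_level_shift[OF i _ c] by (intro mult_left_mono add_left_mono sum_mono) auto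
  also have "\<dots> \<le> ennreal ?n * (ennreal (2 powr p) * (ennreal (1 + c) * ?E) +
        (\<Sum>j\<in>I - {i}. ennreal (2 powr p) * (ennreal (1 + c) * ?L j)))"
    by (intro mult_left_mono add_mono sum_mono c_le) simp_all
  also have "\<dots> = ennreal ((2 * real (card I)) powr p * (1 + c)) * (?E + (\<Sum>j\<in>I - {i}. ?L j))"
    using c by (simp add: powr_mult ennreal_mult distrib_left sum_distrib_left ac_simps)
  finally show ?thesis .
qed

end

lemma suminf_split_head_ennreal: "(\<Sum>k. u k) = u 0 + (\<Sum>k. u (Suc k))" for u :: "nat \<Rightarrow> ennreal"
  using suminf_offset[of u 1] by (simp add: add.commute)

definition osc_energy ::
    "real \<Rightarrow> real \<Rightarrow> 'a::metric_space measure \<Rightarrow> ('a \<Rightarrow> real) \<Rightarrow> ennreal" where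
  "osc_energy s p H f = (\<Sum>k. osc_level s p H H f (Suc k))"

definition gluing_energy ::
    "'a::metric_space measure \<Rightarrow> real \<Rightarrow> real \<Rightarrow> 'a measure \<Rightarrow> 'a measure \<Rightarrow> ('a \<Rightarrow> real) \<Rightarrow> ennreal" where
  "gluing_energy M s p H H' f = (\<Sum>k. gluing_level M s p H H' f (Suc k))"

context regular_family
begin

definition energy :: "('a \<Rightarrow> real) \<Rightarrow> ennreal" where
  "energy f = (\<Sum>i\<in>I. Lp_energy p (H i) f + osc_energy (p - t i) p (H i) f) +
    (\<Sum>i\<in>I. \<Sum>j\<in>I - {i}. gluing_energy M (p - t i - t j) p (H i) (H j) f)"

lemma sum_Lp_energy_le_energy: "(\<Sum>i\<in>I. Lp_energy p (H i) f) \<le> energy f"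
  by (simp add: energy_def sum.distrib add.assoc add_increasing2)

lemma Lp_energy_m_0_le:
  assumes [measurable]: "f \<in> borel_measurable borel"
  shows "Lp_energy p (m 0) f \<le> energy f"
proof -
  have "Lp_energy p (m 0) f = (\<Sum>i\<in>I. Lp_energy p (H i) f)"
    unfolding Lp_energy_def m_def
    by (subst nn_integral_sum_measure) (auto simp: sets_H level_coeff_def)
  then show ?thesis
    by (simp add: sum_Lp_energy_le_energy)
qed

lemma osc_level_m_1_le:
  assumes f: "f \<in> borel_measurable borel"
  shows "osc_level (\<theta> - p) p (m 1) (m 1) f 1 \<le> ennreal (\<Sum>i\<in>I. Cd * K i / \<kappa> i * 2 powr p) * energy f"
proof -
  have "osc_level (\<theta> - p) p (m 1) (m 1) f 1 \<le> (\<Sum>i\<in>I. osc_level (p - t i) p (m 1) (H i) f 1)"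
    by (rule osc_level_m_le[OF f])
  also have "\<dots> \<le> (\<Sum>i\<in>I. ennreal (Cd * K i / \<kappa> i * 2 powr p) * energy f)"
  proof (rule sum_mono)
    fix i assume "i \<in> I"
    then have "osc_level (p - t i) p (m 1) (H i) f 1
        \<le> ennreal (Cd * K i / \<kappa> i * 2 powr p) * (\<Sum>j\<in>I. Lp_energy p (H j) f)"
      using osc_level_le_Lp_energy[OF _ f, of i 1] by simp
    also have "\<dots> \<le> ennreal (Cd * K i / \<kappa> i * 2 powr p) * energy f"
      by (intro mult_left_mono sum_Lp_energy_le_energy) simp
    finally show "osc_level (p - t i) p (m 1) (H i) f 1 \<le> ennreal (Cd * K i / \<kappa> i * 2 powr p) * energy f" .
  qed
  also have "\<dots> = ennreal (\<Sum>i\<in>I. Cd * K i / \<kappa> i * 2 powr p) * energy f"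
    using \<kappa>_pos K_pos Cd_ge_1
    by (subst sum_ennreal[symmetric]) (auto simp: sum_distrib_right less_imp_le simp del: sum_ennreal)
  finally show ?thesis .
qed

lemma suminf_osc_level_Suc_Suc_le:
  assumes f: "f \<in> borel_measurable borel"
  defines "c i \<equiv> (2 * real (card I)) powr p * (1 + Cd ^ 4 * K i / (\<kappa> i)\<^sup>2)"
  shows "(\<Sum>k. osc_level (\<theta> - p) p (m (Suc (Suc k))) (m (Suc (Suc k))) f (Suc (Suc k)))
    \<le> ennreal (\<Sum>i\<in>I. c i) * energy f"
proof -
  define C where "C = (\<Sum>i\<in>I. c i)"
  have c: "0 \<le> c i" if "i \<in> I" for i
    using K_pos[OF that] Cd_ge_1 by (simp add: c_def)
  define u where "u i k = osc_level (p - t i) p (H i) (H i) f (Suc k)" for i k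
  define v where "v i k = (\<Sum>j\<in>I - {i}. gluing_level M (p - t i - t j) p (H i) (H j) f (Suc k))" for i k
  have "osc_level (\<theta> - p) p (m (Suc (Suc k))) (m (Suc (Suc k))) f (Suc (Suc k))
      \<le> ennreal C * (\<Sum>i\<in>I. u i (Suc k) + v i k)" for k
  proof -
    have "osc_level (\<theta> - p) p (m (Suc (Suc k))) (m (Suc (Suc k))) f (Suc (Suc k))
        \<le> (\<Sum>i\<in>I. osc_level (p - t i) p (m (Suc (Suc k))) (H i) f (Suc (Suc k)))"
      by (rule osc_level_m_le[OF f])
    also have "\<dots> \<le> (\<Sum>i\<in>I. ennreal (c i) * (u i (Suc k) + v i k))"
      unfolding c_def u_def v_def by (intro sum_mono osc_level_Suc_le f)
    also have "\<dots> \<le> (\<Sum>i\<in>I. ennreal C * (u i (Suc k) + v i k))"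
      unfolding C_def using finite_I c by (intro sum_mono mult_right_mono ennreal_leI member_le_sum) auto
    finally show ?thesis
      by (simp add: sum_distrib_left)
  qed
  then have "(\<Sum>k. osc_level (\<theta> - p) p (m (Suc (Suc k))) (m (Suc (Suc k))) f (Suc (Suc k)))
      \<le> (\<Sum>k. ennreal C * (\<Sum>i\<in>I. u i (Suc k) + v i k))"
    by (intro suminf_le) auto
  also have "\<dots> = ennreal C * (\<Sum>i\<in>I. (\<Sum>k. u i (Suc k)) + (\<Sum>k. v i k))"
    by (simp add: suminf_sum suminf_add[symmetric])
  also have "\<dots> \<le> ennreal C * (\<Sum>i\<in>I. (\<Sum>k. u i k) + (\<Sum>k. v i k))"
    by (intro mult_left_mono sum_mono add_right_mono) (simp_all add: suminf_split_head_ennreal[of "u _"])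
  also have "\<dots> \<le> ennreal C * energy f"
    unfolding energy_def osc_energy_def gluing_energy_def u_def v_def
    by (intro mult_left_mono) (simp_all add: suminf_sum sum.distrib add_right_mono)
  finally show ?thesis
    unfolding C_def .
qed

lemma suminf_osc_level_m_le:
  "\<exists>C\<ge>0. \<forall>f\<in>borel_measurable borel.
    (\<Sum>k. osc_level (\<theta> - p) p (m (Suc k)) (m (Suc k)) f (Suc k)) \<le> ennreal C * energy f"
proof (intro exI conjI ballI)
  let ?C = "(\<Sum>i\<in>I. Cd * K i / \<kappa> i * 2 powr p) +
    (\<Sum>i\<in>I. (2 * real (card I)) powr p * (1 + Cd ^ 4 * K i / (\<kappa> i)\<^sup>2))"
  have nonneg: "0 \<le> (\<Sum>i\<in>I. Cd * K i / \<kappa> i * 2 powr p)"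
    "0 \<le> (\<Sum>i\<in>I. (2 * real (card I)) powr p * (1 + Cd ^ 4 * K i / (\<kappa> i)\<^sup>2))"
    using K_pos \<kappa>_pos Cd_ge_1 by (auto intro!: sum_nonneg add_nonneg_nonneg simp: less_imp_le)
  then show "0 \<le> ?C"
    by simp
  fix f :: "'a \<Rightarrow> real" assume f: "f \<in> borel_measurable borel"
  show "(\<Sum>k. osc_level (\<theta> - p) p (m (Suc k)) (m (Suc k)) f (Suc k)) \<le> ennreal ?C * energy f"
    using add_mono[OF osc_level_m_1_le[OF f] suminf_osc_level_Suc_Suc_le[OF f]] nonneg
    by (subst suminf_split_head_ennreal) (simp add: distrib_right)
qed

lemma BN_le_energy:
  "\<exists>C\<ge>0. \<forall>S \<sigma>. \<forall>f\<in>borel_measurable borel. S \<in> null_sets M \<longrightarrow>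
    BN M p \<theta> m S \<sigma> f \<le> ennreal (1 + C) * epow (energy f) (1 / p)"
proof -
  obtain C where C: "0 \<le> C" "\<And>f. f \<in> borel_measurable borel \<Longrightarrow>
      (\<Sum>k. osc_level (\<theta> - p) p (m (Suc k)) (m (Suc k)) f (Suc k)) \<le> ennreal C * energy f"
    using suminf_osc_level_m_le by blast
  have "BN M p \<theta> m S \<sigma> f \<le> ennreal (1 + C powr (1 / p)) * epow (energy f) (1 / p)"
    if f: "f \<in> borel_measurable borel" and S: "S \<in> null_sets M" for S \<sigma> f
  proof -
    have "epow (Lp_energy p (m 0) f) (1 / p) \<le> epow (energy f) (1 / p)"
      using p_ge_1 by (intro epow_mono Lp_energy_m_0_le f) simp
    moreover have "(\<integral>\<^sup>+x. epow (sharp m S f x) p * indicator S x \<partial>M) = 0"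
      using S by (rule nn_integral_null_set)
    moreover have "(\<Sum>k. ennreal (2 powr (real (Suc k) * (\<theta> - p))) *
        (\<integral>\<^sup>+x. epow (Eosc (m (Suc k)) f (cball x ((1/2)^(Suc k)))) p
          * indicator (porous_part S ((1/2)^(Suc k)) \<sigma>) x \<partial>m (Suc k))) \<le> ennreal C * energy f"
      (is "?P \<le> _")
    proof -
      have "?P \<le> (\<Sum>k. osc_level (\<theta> - p) p (m (Suc k)) (m (Suc k)) f (Suc k))"
        unfolding osc_level_def
        by (intro suminf_le mult_left_mono nn_integral_mono) (auto split: split_indicator)
      also have "\<dots> \<le> ennreal C * energy f"
        by (rule C(2)[OF f])
      finally show ?thesis .
    qed
    then have "epow ?P (1 / p) \<le> ennreal (C powr (1 / p)) * epow (energy f) (1 / p)"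
      using epow_mono[of ?P "ennreal C * energy f" "1 / p"] p_ge_1 C(1) by (simp add: epow_mult epow_ennreal)
    ultimately show ?thesis
      by (simp add: BN_def Lpnorm_def Lp_energy_def distrib_right add_mono)
  qed
  then show ?thesis
    by (intro exI[of _ "C powr (1 / p)"]) auto
qed

end

subsection \<open>Metric outer measures\<close>

locale metric_outer_measure =
  fixes \<phi> :: "'a::metric_space set \<Rightarrow> ennreal"
  assumes empty: "\<phi> {} = 0"
    and mono: "A \<subseteq> B \<Longrightarrow> \<phi> A \<le> \<phi> B"
    and countably_subadditive: "\<phi> (\<Union>n. X n) \<le> (\<Sum>n. \<phi> (X n))"
    and separated: "0 < e \<Longrightarrow> (\<And>x y. x \<in> A \<Longrightarrow> y \<in> B \<Longrightarrow> e \<le> dist x y) \<Longrightarrow> \<phi> A + \<phi> B \<le> \<phi> (A \<union> B)"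
begin

lemma subadditive: "\<phi> (A \<union> B) \<le> \<phi> A + \<phi> B"
proof -
  have "(\<Sum>n. \<phi> (binaryset A B n)) = \<phi> A + \<phi> B"
    by (intro sums_unique[symmetric] binaryset_sums empty)
  then show ?thesis
    using countably_subadditive[of "binaryset A B"] by (simp add: UN_binaryset_eq)
qed

definition outer_part :: "'a set \<Rightarrow> 'a set \<Rightarrow> nat \<Rightarrow> 'a set" where
  "outer_part A C n = {x\<in>A. 1 / Suc n \<le> infdist x C}"

definition layer :: "'a set \<Rightarrow> 'a set \<Rightarrow> nat \<Rightarrow> 'a set" where
  "layer A C n = outer_part A C (Suc n) - outer_part A C n"

lemma outer_part_mono:
  assumes "n \<le> l"
  shows "outer_part A C n \<subseteq> outer_part A C l"
proof -
  have "1 / real (Suc l) \<le> 1 / real (Suc n)"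
    using assms by (intro divide_left_mono) auto
  then show ?thesis
    by (auto simp: outer_part_def)
qed

lemma outer_part_subset: "outer_part A C n \<subseteq> A"
  by (auto simp: outer_part_def)

text \<open>A layer has positive distance from the outer part one level further away from \<open>C\<close>. The resulting
  inequalities telescope, so the layers have finite total mass.\<close>

lemma layer_add_outer_part_le: "\<phi> (layer A C (Suc n)) + \<phi> (outer_part A C n) \<le> \<phi> (outer_part A C (Suc (Suc n)))"
proof -
  have "1 / Suc n - 1 / Suc (Suc n) \<le> dist x y" if "x \<in> layer A C (Suc n)" "y \<in> outer_part A C n" for x y
    using that infdist_triangle[of y C x] by (auto simp: layer_def outer_part_def dist_commute)
  moreover have "0 < 1 / real (Suc n) - 1 / Suc (Suc n)"
    by (simp add: frac_less2)
  ultimately have "\<phi> (layer A C (Suc n)) + \<phi> (outer_part A C n) \<le> \<phi> (layer A C (Suc n) \<union> outer_part A C n)"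
    by (intro separated)
  also have "\<dots> \<le> \<phi> (outer_part A C (Suc (Suc n)))"
    using outer_part_mono[of n "Suc (Suc n)" A C] by (intro mono) (auto simp: layer_def)
  finally show ?thesis .
qed

lemma suminf_layer_le: "(\<Sum>n. \<phi> (layer A C (Suc n))) \<le> \<phi> A + \<phi> A"
proof -
  have "(\<Sum>k<n. \<phi> (layer A C (Suc k))) \<le> \<phi> (outer_part A C n) + \<phi> (outer_part A C (Suc n))" for n
  proof (induction n)
    case (Suc n)
    then have "(\<Sum>k<Suc n. \<phi> (layer A C (Suc k)))
        \<le> (\<phi> (outer_part A C n) + \<phi> (outer_part A C (Suc n))) + \<phi> (layer A C (Suc n))"
      by (simp add: add_right_mono)
    also have "\<dots> = \<phi> (outer_part A C (Suc n)) + (\<phi> (layer A C (Suc n)) + \<phi> (outer_part A C n))"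
      by (simp add: ac_simps)
    also have "\<dots> \<le> \<phi> (outer_part A C (Suc n)) + \<phi> (outer_part A C (Suc (Suc n)))"
      by (intro add_left_mono layer_add_outer_part_le)
    finally show ?case .
  qed simp
  also have "\<phi> (outer_part A C n) + \<phi> (outer_part A C (Suc n)) \<le> \<phi> A + \<phi> A" for n
    by (intro add_mono mono outer_part_subset)
  finally have "(\<Sum>k<n. \<phi> (layer A C (Suc k))) \<le> \<phi> A + \<phi> A" for n .
  then show ?thesis
    by (intro suminf_le_const) auto
qed

lemma diff_closed_subset:
  assumes "closed C" "C \<noteq> {}"
  shows "A - C \<subseteq> outer_part A C n \<union> (\<Union>k. layer A C (k + n))"
proof
  fix x assume x: "x \<in> A - C"
  then have "0 < infdist x C"
    using assms by (simp add: infdist_pos_not_in_closed)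
  then obtain l where "1 / Suc l \<le> infdist x C"
    using nat_approx_posE by (metis less_imp_le)
  then have ex: "\<exists>l. x \<in> outer_part A C l"
    using x by (auto simp: outer_part_def)
  define l where "l = (LEAST l. x \<in> outer_part A C l)"
  have l: "x \<in> outer_part A C l"
    unfolding l_def using ex by (rule LeastI_ex)
  show "x \<in> outer_part A C n \<union> (\<Union>k. layer A C (k + n))"
  proof (cases "l \<le> n")
    case True
    then show ?thesis
      using l outer_part_mono by blast
  next
    case False
    then obtain k where k: "l = Suc (k + n)"
      using less_imp_Suc_add[of n l] by (auto simp: add.commute)
    then have "x \<notin> outer_part A C (k + n)"
      unfolding l_def by (intro not_less_Least) simp
    then show ?thesis
      using l k by (auto simp: layer_def)
  qed
qed

lemma outer_part_approx:
  assumes C: "closed C" "C \<noteq> {}" and A: "\<phi> A < \<infinity>" and e: "0 < e"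
  obtains n where "\<phi> (A - C) \<le> \<phi> (outer_part A C n) + ennreal e"
proof -
  have "(\<Sum>k. \<phi> (layer A C (Suc k))) < top"
    using suminf_layer_le[of A C] A by (simp add: le_less_trans)
  then have fin: "(\<Sum>k. \<phi> (layer A C (Suc k))) \<noteq> top" "\<phi> (layer A C (Suc k)) < top" for k
    by (auto dest: ennreal_suminf_lessD)
  define d where "d k = enn2real (\<phi> (layer A C (Suc k)))" for k
  have d: "\<phi> (layer A C (Suc k)) = ennreal (d k)" "0 \<le> d k" for k
    using fin(2) by (simp_all add: d_def)
  then have summable: "summable d"
    using fin(1) by (intro summable_suminf_not_top) auto
  then obtain n where "norm (\<Sum>k. d (k + n)) < e"
    using suminf_exist_split[OF e] by blast
  then have tail: "(\<Sum>k. \<phi> (layer A C (Suc (k + n)))) \<le> ennreal e"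
    using d(2) summable by (simp add: d(1) suminf_ennreal2 summable_iff_shift ennreal_leI)
  have "\<phi> (A - C) \<le> \<phi> (outer_part A C (Suc n) \<union> (\<Union>k. layer A C (k + Suc n)))"
    by (intro mono diff_closed_subset C)
  also have "\<dots> \<le> \<phi> (outer_part A C (Suc n)) + (\<Sum>k. \<phi> (layer A C (k + Suc n)))"
    by (rule order_trans[OF subadditive add_left_mono[OF countably_subadditive]])
  also have "\<dots> \<le> \<phi> (outer_part A C (Suc n)) + ennreal e"
    using tail by (intro add_left_mono) simp
  finally show ?thesis
    by (rule that)
qed

lemma closed_caratheodory:
  assumes "closed C"
  shows "\<phi> (A \<inter> C) + \<phi> (A - C) \<le> \<phi> A"
proof (cases "C = {} \<or> \<phi> A = \<infinity>")
  case False
  then have A: "\<phi> A < \<infinity>"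
    by (simp add: less_top)
  show ?thesis
  proof (rule ennreal_le_epsilon)
    fix e :: real assume "0 < e"
    then obtain n where n: "\<phi> (A - C) \<le> \<phi> (outer_part A C n) + ennreal e"
      using outer_part_approx[OF assms _ A] False by blast
    have "1 / Suc n \<le> dist x y" if "x \<in> A \<inter> C" "y \<in> outer_part A C n" for x y
      using that infdist_le[of x C y] by (auto simp: outer_part_def dist_commute)
    then have "\<phi> (A \<inter> C) + \<phi> (outer_part A C n) \<le> \<phi> (A \<inter> C \<union> outer_part A C n)"
      by (intro separated[of "1 / Suc n"]) auto
    also have "\<dots> \<le> \<phi> A"
      using outer_part_subset by (intro mono) auto
    finally have "\<phi> (A \<inter> C) + \<phi> (outer_part A C n) + ennreal e \<le> \<phi> A + ennreal e"
      by (rule add_right_mono)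
    with add_left_mono[OF n] show "\<phi> (A \<inter> C) + \<phi> (A - C) \<le> \<phi> A + ennreal e"
      unfolding add.assoc by (rule order_trans)
  qed
qed (auto simp: empty)

lemma measure_space_borel: "measure_space UNIV (sets borel) \<phi>"
proof -
  let ?L = "lambda_system UNIV (Pow UNIV) \<phi>"
  interpret Pow: sigma_algebra UNIV "Pow UNIV :: 'a set set"
    by (rule sigma_algebra_Pow)
  have "outer_measure_space (Pow UNIV) \<phi>"
    unfolding outer_measure_space_def positive_def increasing_def countably_subadditive_def
    using empty mono countably_subadditive by auto
  then have L: "measure_space UNIV ?L \<phi>"
    by (rule Pow.caratheodory_lemma)
  have "\<phi> (A \<inter> C) + \<phi> (A - C) = \<phi> A" if "closed C" for A C
    using closed_caratheodory[OF that] subadditive[of "A \<inter> C" "A - C"]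
    by (intro antisym) (simp_all add: Int_Diff_Un)
  then have "Collect closed \<subseteq> ?L"
    unfolding Pow.lambda_system_eq by auto
  then have "sets borel \<subseteq> ?L"
    unfolding borel_eq_closed using L by (simp add: measure_space_def sigma_algebra.sigma_sets_subset)
  then show ?thesis
    using L sets.sigma_algebra_axioms[of borel] by (auto intro: measure_down)
qed

lemma metric_outer_measure_Int: "metric_outer_measure (\<lambda>E. \<phi> (E \<inter> A))"
proof
  show "\<phi> (B \<inter> A) + \<phi> (D \<inter> A) \<le> \<phi> ((B \<union> D) \<inter> A)"
    if "0 < e" "\<And>x y. x \<in> B \<Longrightarrow> y \<in> D \<Longrightarrow> e \<le> dist x y" for e B D
    using separated[of e "B \<inter> A" "D \<inter> A"] that by (simp add: Int_Un_distrib2)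
  show "\<phi> ((\<Union>n. X n) \<inter> A) \<le> (\<Sum>n. \<phi> (X n \<inter> A))" for X :: "nat \<Rightarrow> 'a set"
    using countably_subadditive[of "\<lambda>n. X n \<inter> A"] by (simp add: Int_UN_distrib2)
qed (auto simp: empty intro: mono)

end

subsection \<open>Codimensional Hausdorff measures\<close>

definition fine_covers :: "real \<Rightarrow> 'a::metric_space set \<Rightarrow> ('a \<times> real) set set" where
  "fine_covers \<delta> E =
    {F. countable F \<and> (\<forall>b\<in>F. 0 < snd b \<and> snd b < \<delta>) \<and> E \<subseteq> (\<Union>b\<in>F. cball (fst b) (snd b))}"

definition cover_weight :: "'a::metric_space measure \<Rightarrow> real \<Rightarrow> ('a \<times> real) set \<Rightarrow> ennreal" where
  "cover_weight M vt F =
    (\<integral>\<^sup>+b. emeasure M (cball (fst b) (snd b)) * ennreal (snd b powr (-vt)) \<partial>count_space F)"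

lemma Hdelta_eq_INF: "Hdelta M vt \<delta> E = (INF F\<in>fine_covers \<delta> E. cover_weight M vt F)"
  by (simp add: Hdelta_def fine_covers_def cover_weight_def case_prod_beta)

lemma Hdelta_le_cover_weight: "F \<in> fine_covers \<delta> E \<Longrightarrow> Hdelta M vt \<delta> E \<le> cover_weight M vt F"
  unfolding Hdelta_eq_INF by (rule INF_lower)

lemma cover_weight_UN_le: "cover_weight M vt (\<Union>n. F n) \<le> (\<Sum>n. cover_weight M vt (F n))"
proof -
  let ?w = "\<lambda>b. emeasure M (cball (fst b) (snd b)) * ennreal (snd b powr (-vt))"
  have "indicator (\<Union>n. F n) b \<le> (\<Sum>n. indicator (F n) b :: ennreal)" for b
  proof (cases "b \<in> (\<Union>n. F n)")
    case True
    then obtain n where "b \<in> F n"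
      by auto
    then have "1 = (\<Sum>k\<in>{n}. indicator (F k) b :: ennreal)"
      by simp
    also have "\<dots> \<le> (\<Sum>n. indicator (F n) b)"
      by (intro sum_le_suminf) auto
    finally show ?thesis
      using True by simp
  qed simp
  then have "(\<integral>\<^sup>+b. ?w b * indicator (\<Union>n. F n) b \<partial>count_space UNIV)
      \<le> (\<integral>\<^sup>+b. (\<Sum>n. ?w b * indicator (F n) b) \<partial>count_space UNIV)"
    by (intro nn_integral_mono) (simp add: mult_left_mono)
  also have "\<dots> = (\<Sum>n. \<integral>\<^sup>+b. ?w b * indicator (F n) b \<partial>count_space UNIV)"
    by (rule nn_integral_suminf) simp
  finally show ?thesis
    by (simp add: cover_weight_def nn_integral_count_space_indicator)
qed

lemma cover_weight_add_le:
  assumes "F \<inter> F' = {}" "F \<union> F' \<subseteq> G"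
  shows "cover_weight M vt F + cover_weight M vt F' \<le> cover_weight M vt G"
proof -
  let ?w = "\<lambda>b. emeasure M (cball (fst b) (snd b)) * ennreal (snd b powr (-vt))"
  have "(\<integral>\<^sup>+b. ?w b * indicator F b \<partial>count_space UNIV) + (\<integral>\<^sup>+b. ?w b * indicator F' b \<partial>count_space UNIV)
      = (\<integral>\<^sup>+b. ?w b * indicator F b + ?w b * indicator F' b \<partial>count_space UNIV)"
    by (simp add: nn_integral_add)
  also have "\<dots> \<le> (\<integral>\<^sup>+b. ?w b * indicator G b \<partial>count_space UNIV)"
    using assms by (intro nn_integral_mono) (auto split: split_indicator)
  finally show ?thesis
    by (simp add: cover_weight_def nn_integral_count_space_indicator)
qed

lemma Hdelta_empty: "Hdelta M vt \<delta> {} = 0"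
  using Hdelta_le_cover_weight[of "{}" \<delta> "{}" M vt]
  by (simp add: fine_covers_def cover_weight_def nn_integral_empty)

lemma Hdelta_mono: "A \<subseteq> B \<Longrightarrow> Hdelta M vt \<delta> A \<le> Hdelta M vt \<delta> B"
  unfolding Hdelta_eq_INF by (rule INF_superset_mono) (auto simp: fine_covers_def)

lemma Hdelta_antimono:
  assumes "\<delta> \<le> \<delta>'"
  shows "Hdelta M vt \<delta>' A \<le> Hdelta M vt \<delta> A"
proof -
  have "fine_covers \<delta> A \<subseteq> fine_covers \<delta>' A"
    by (auto simp: fine_covers_def intro: less_le_trans[OF _ assms])
  then show ?thesis
    unfolding Hdelta_eq_INF by (rule INF_superset_mono) simp
qed

lemma Hdelta_countably_subadditive: "Hdelta M vt \<delta> (\<Union>n. X n) \<le> (\<Sum>n. Hdelta M vt \<delta> (X n))"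
proof (rule ennreal_le_epsilon)
  fix e :: real assume e: "0 < e" and fin: "(\<Sum>n. Hdelta M vt \<delta> (X n)) < top"
  define \<eta> where "\<eta> n = e * (1/2) ^ Suc n" for n
  have \<eta>: "0 < \<eta> n" for n
    using e by (simp add: \<eta>_def)
  have sum_\<eta>: "(\<Sum>n. ennreal (\<eta> n)) = ennreal e"
    using sums_mult[OF power_half_series, of e] \<eta> unfolding \<eta>_def[symmetric]
    by (intro suminf_ennreal_eq) (simp_all add: less_imp_le)
  have "\<exists>F\<in>fine_covers \<delta> (X n). cover_weight M vt F < Hdelta M vt \<delta> (X n) + ennreal (\<eta> n)" for n
  proof -
    have "Hdelta M vt \<delta> (X n) < Hdelta M vt \<delta> (X n) + ennreal (\<eta> n)"
      using ennreal_suminf_lessD[OF fin, of n] \<eta>[of n]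
        ennreal_add_left_cancel_less[of "Hdelta M vt \<delta> (X n)" 0 "ennreal (\<eta> n)"]
      by simp
    then show ?thesis
      unfolding Hdelta_eq_INF[of M vt \<delta> "X n"] INF_less_iff .
  qed
  then obtain F where F: "\<And>n. F n \<in> fine_covers \<delta> (X n)"
    and F_less: "\<And>n. cover_weight M vt (F n) < Hdelta M vt \<delta> (X n) + ennreal (\<eta> n)"
    by metis
  have "(\<Union>n. X n) \<subseteq> (\<Union>n. \<Union>b\<in>F n. cball (fst b) (snd b))"
    using F by (intro UN_mono) (simp_all add: fine_covers_def)
  then have "(\<Union>n. F n) \<in> fine_covers \<delta> (\<Union>n. X n)"
    using F by (simp add: fine_covers_def)
  then have "Hdelta M vt \<delta> (\<Union>n. X n) \<le> cover_weight M vt (\<Union>n. F n)"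
    by (rule Hdelta_le_cover_weight)
  also have "\<dots> \<le> (\<Sum>n. cover_weight M vt (F n))"
    by (rule cover_weight_UN_le)
  also have "\<dots> \<le> (\<Sum>n. Hdelta M vt \<delta> (X n) + ennreal (\<eta> n))"
    using F_less by (intro suminf_le less_imp_le) auto
  also have "\<dots> = (\<Sum>n. Hdelta M vt \<delta> (X n)) + ennreal e"
    by (simp only: suminf_add[symmetric] summableI sum_\<eta>)
  finally show "Hdelta M vt \<delta> (\<Union>n. X n) \<le> (\<Sum>n. Hdelta M vt \<delta> (X n)) + ennreal e" .
qed

lemma Hdelta_separated:
  assumes sep: "\<And>x y. x \<in> A \<Longrightarrow> y \<in> B \<Longrightarrow> 2 * \<delta> \<le> dist x y"
  shows "Hdelta M vt \<delta> A + Hdelta M vt \<delta> B \<le> Hdelta M vt \<delta> (A \<union> B)"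
  unfolding Hdelta_eq_INF[of M vt \<delta> "A \<union> B"]
proof (rule INF_greatest)
  fix F assume F: "F \<in> fine_covers \<delta> (A \<union> B)"
  define meeting where "meeting E = {b\<in>F. cball (fst b) (snd b) \<inter> E \<noteq> {}}" for E
  have "meeting E \<in> fine_covers \<delta> E" if E: "E \<subseteq> A \<union> B" for E
  proof -
    have "E \<subseteq> (\<Union>b\<in>F. cball (fst b) (snd b))"
      using F E by (auto simp: fine_covers_def)
    then have "E \<subseteq> (\<Union>b\<in>meeting E. cball (fst b) (snd b))"
      unfolding meeting_def by blast
    moreover have "countable (meeting E)"
      using F by (intro countable_subset[of "meeting E" F]) (auto simp: meeting_def fine_covers_def)
    ultimately show ?thesis
      using F by (auto simp: meeting_def fine_covers_def)
  qed
  then have "Hdelta M vt \<delta> A + Hdelta M vt \<delta> B \<le> cover_weight M vt (meeting A) + cover_weight M vt (meeting B)"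
    by (intro add_mono Hdelta_le_cover_weight) auto
  also have "\<dots> \<le> cover_weight M vt F"
  proof (rule cover_weight_add_le)
    have False if "b \<in> F" "u \<in> cball (fst b) (snd b) \<inter> A" "v \<in> cball (fst b) (snd b) \<inter> B" for b u v
    proof -
      have "snd b < \<delta>"
        using F that(1) by (simp add: fine_covers_def)
      moreover have "dist u v \<le> snd b + snd b"
        using that dist_triangle3[of u v "fst b"] by simp
      moreover have "2 * \<delta> \<le> dist u v"
        using that by (intro sep) auto
      ultimately show False
        by simp
    qed
    then show "meeting A \<inter> meeting B = {}"
      unfolding meeting_def by blast
  qed (auto simp: meeting_def)
  finally show "Hdelta M vt \<delta> A + Hdelta M vt \<delta> B \<le> cover_weight M vt F" .
qed

lemma Hdelta_le_Hcal: "0 < \<delta> \<Longrightarrow> Hdelta M vt \<delta> A \<le> Hcal M vt A"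
  unfolding Hcal_def by (rule SUP_upper) simp

lemma metric_outer_measure_Hcal: "metric_outer_measure (Hcal M vt)"
proof
  show "Hcal M vt {} = 0"
    by (simp add: Hcal_def Hdelta_empty)
  show "Hcal M vt A \<le> Hcal M vt B" if "A \<subseteq> B" for A B
    unfolding Hcal_def using that by (intro SUP_mono) (auto intro: Hdelta_mono)
  show "Hcal M vt (\<Union>n. X n) \<le> (\<Sum>n. Hcal M vt (X n))" for X :: "nat \<Rightarrow> 'a set"
    unfolding Hcal_def[of M vt "\<Union>n. X n"]
    by (intro SUP_least order_trans[OF Hdelta_countably_subadditive] suminf_le Hdelta_le_Hcal) auto
  show "Hcal M vt A + Hcal M vt B \<le> Hcal M vt (A \<union> B)"
    if e: "0 < e" and sep: "\<And>x y. x \<in> A \<Longrightarrow> y \<in> B \<Longrightarrow> e \<le> dist x y" for e A B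
  proof -
    have "Hdelta M vt \<delta> A + Hdelta M vt \<delta>' B \<le> Hcal M vt (A \<union> B)" if \<delta>: "0 < \<delta>" "0 < \<delta>'" for \<delta> \<delta>'
    proof -
      define \<eta> where "\<eta> = min (e / 2) (min \<delta> \<delta>')"
      have "Hdelta M vt \<delta> A + Hdelta M vt \<delta>' B \<le> Hdelta M vt \<eta> A + Hdelta M vt \<eta> B"
        by (intro add_mono Hdelta_antimono) (auto simp: \<eta>_def)
      also have "\<dots> \<le> Hdelta M vt \<eta> (A \<union> B)"
        using sep by (intro Hdelta_separated) (force simp: \<eta>_def)
      also have "\<dots> \<le> Hcal M vt (A \<union> B)"
        using e \<delta> by (intro Hdelta_le_Hcal) (simp add: \<eta>_def)
      finally show ?thesis .
    qed
    then have "Hcal M vt A + Hdelta M vt \<delta>' B \<le> Hcal M vt (A \<union> B)" if "0 < \<delta>'" for \<delta>'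
      unfolding Hcal_def[of M vt A] using that by (subst ennreal_SUP_add_left[symmetric]) (auto intro: SUP_least)
    then show ?thesis
      unfolding Hcal_def[of M vt B] by (subst ennreal_SUP_add_right) (auto intro: SUP_least)
  qed
qed

lemma sets_Hrestr: "sets (Hrestr M vt S) = sets borel"
  unfolding Hrestr_def by (subst sets_measure_of) (auto simp: sets.sigma_sets_eq[of borel, simplified])

lemma emeasure_Hrestr:
  fixes M :: "'a::metric_space measure"
  assumes "E \<in> sets borel"
  shows "emeasure (Hrestr M vt S) E = Hcal M vt (E \<inter> S)"
proof (rule emeasure_measure_of[OF Hrestr_def])
  interpret metric_outer_measure "\<lambda>E. Hcal M vt (E \<inter> S)"
    by (rule metric_outer_measure.metric_outer_measure_Int[OF metric_outer_measure_Hcal])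
  show "positive (sets (Hrestr M vt S)) (\<lambda>E. Hcal M vt (E \<inter> S))"
    "countably_additive (sets (Hrestr M vt S)) (\<lambda>E. Hcal M vt (E \<inter> S))"
    using measure_space_borel by (auto simp: sets_Hrestr measure_space_def)
qed (use assms in \<open>auto simp: sets_Hrestr\<close>)

lemma emeasure_le_nn_integral_count_space:
  assumes F: "countable F" and X: "\<And>b. b \<in> F \<Longrightarrow> X b \<in> sets M" and E: "E \<in> sets M" "E \<subseteq> (\<Union>b\<in>F. X b)"
  shows "emeasure M E \<le> (\<integral>\<^sup>+b. emeasure M (X b) \<partial>count_space F)"
proof -
  have "indicator E x \<le> (\<integral>\<^sup>+b. indicator (X b) x \<partial>count_space F)" for x
  proof (cases "x \<in> E")
    case True
    then obtain b where b: "b \<in> F" "x \<in> X b"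
      using E by blast
    have "1 = (\<integral>\<^sup>+b'. indicator {b} b' \<partial>count_space F)"
      using b(1) by simp
    also have "\<dots> \<le> (\<integral>\<^sup>+b. indicator (X b) x \<partial>count_space F)"
      using b(2) by (intro nn_integral_mono) (auto split: split_indicator)
    finally show ?thesis
      using True by simp
  qed simp
  then have "(\<integral>\<^sup>+x. indicator E x \<partial>M) \<le> (\<integral>\<^sup>+x. \<integral>\<^sup>+b. indicator (X b) x \<partial>count_space F \<partial>M)"
    by (intro nn_integral_mono)
  also have "\<dots> = (\<integral>\<^sup>+b. \<integral>\<^sup>+x. indicator (X b) x \<partial>M \<partial>count_space F)"
    by (intro nn_integral_count_space_nn_integral F borel_measurable_indicator X)
  also have "\<dots> = (\<integral>\<^sup>+b. emeasure M (X b) \<partial>count_space F)"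
    using X by (intro nn_integral_cong nn_integral_indicator) simp
  finally show ?thesis
    using E by simp
qed

lemma emeasure_le_cover_weight:
  fixes M :: "'a::metric_space measure"
  assumes M: "sets M = sets borel" and vt: "0 \<le> vt" and F: "F \<in> fine_covers \<delta> E" and E: "E \<in> sets borel"
  shows "emeasure M E \<le> ennreal (\<delta> powr vt) * cover_weight M vt F"
proof -
  let ?\<mu> = "\<lambda>b. emeasure M (cball (fst b) (snd b))"
  have "emeasure M E \<le> (\<integral>\<^sup>+b. ?\<mu> b \<partial>count_space F)"
    using F E M by (intro emeasure_le_nn_integral_count_space) (auto simp: fine_covers_def)
  also have "\<dots> \<le> (\<integral>\<^sup>+b. ennreal (\<delta> powr vt) * (?\<mu> b * ennreal (snd b powr (-vt))) \<partial>count_space F)"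
  proof (intro nn_integral_mono)
    fix b assume "b \<in> space (count_space F)"
    then have "0 < snd b" "snd b < \<delta>"
      using F by (auto simp: fine_covers_def)
    then have "1 \<le> \<delta> powr vt * snd b powr (-vt)"
      using vt powr_mono2[of vt "snd b" \<delta>] by (simp add: powr_minus field_simps)
    then have "?\<mu> b * ennreal 1 \<le> ?\<mu> b * ennreal (\<delta> powr vt * snd b powr (-vt))"
      by (intro mult_left_mono ennreal_leI) auto
    then show "?\<mu> b \<le> ennreal (\<delta> powr vt) * (?\<mu> b * ennreal (snd b powr (-vt)))"
      by (simp add: ennreal_mult ac_simps)
  qed
  also have "\<dots> = ennreal (\<delta> powr vt) * cover_weight M vt F"
    unfolding cover_weight_def by (intro nn_integral_cmult) simp
  finally show ?thesis .
qed

lemma Hcal_finite_imp_null: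
  fixes M :: "'a::metric_space measure"
  assumes M: "sets M = sets borel" and vt: "0 < vt" and E: "E \<in> sets borel" and fin: "Hcal M vt E < \<infinity>"
  shows "E \<in> null_sets M"
proof -
  obtain b where b: "Hcal M vt E = ennreal b" "0 \<le> b"
    using fin by (cases "Hcal M vt E") auto
  define c where "c = b + 1"
  have c: "Hcal M vt E < ennreal c" "0 < c"
    using b by (auto simp: c_def intro!: ennreal_lessI)
  have "emeasure M E \<le> 0 + ennreal e" if e: "0 < e" for e
  proof -
    define \<delta> where "\<delta> = (e / c) powr (1 / vt)"
    have \<delta>: "0 < \<delta>" "\<delta> powr vt * c = e"
      using e c(2) vt by (auto simp: \<delta>_def powr_powr)
    have "Hdelta M vt \<delta> E < ennreal c"
      using Hdelta_le_Hcal[OF \<delta>(1)] c(1) by (rule le_less_trans)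
    then obtain F where F: "F \<in> fine_covers \<delta> E" "cover_weight M vt F < ennreal c"
      unfolding Hdelta_eq_INF INF_less_iff by auto
    have "emeasure M E \<le> ennreal (\<delta> powr vt) * cover_weight M vt F"
      using vt by (intro emeasure_le_cover_weight M F E) simp
    also have "\<dots> \<le> ennreal (\<delta> powr vt) * ennreal c"
      using F(2) by (intro mult_left_mono) auto
    also have "\<dots> = ennreal e"
      using \<delta>(2) c(2) by (simp flip: ennreal_mult)
    finally show ?thesis
      by simp
  qed
  then have "emeasure M E \<le> 0"
    by (rule ennreal_le_epsilon)
  then show ?thesis
    using E M by (auto simp: null_sets_def)
qed

subsection \<open>Ahlfors--David regular sets\<close>

lemma ADRE:
  assumes "ADR M vt S"
  obtains k1 k2 where "closed S" "0 < k1" "0 < k2"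
    and "\<And>x r. x \<in> S \<Longrightarrow> 0 < r \<Longrightarrow> r \<le> 1 \<Longrightarrow>
      ennreal k1 * emeasure M (cball x r) * ennreal (r powr - vt) \<le> Hcal M vt (cball x r \<inter> S)"
    and "\<And>x r. x \<in> S \<Longrightarrow> 0 < r \<Longrightarrow> r \<le> 1 \<Longrightarrow>
      Hcal M vt (cball x r \<inter> S) \<le> ennreal k2 * emeasure M (cball x r) * ennreal (r powr - vt)"
  using assms unfolding ADR_def by auto

context doubling_measure
begin

lemma ADR_imp_null:
  assumes S: "ADR M vt S" and vt: "0 < vt"
  shows "S \<in> null_sets M"
proof -
  obtain k2 where cl: "closed S"
    and upper: "\<And>x r. x \<in> S \<Longrightarrow> 0 < r \<Longrightarrow> r \<le> 1 \<Longrightarrow>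
      Hcal M vt (cball x r \<inter> S) \<le> ennreal k2 * emeasure M (cball x r) * ennreal (r powr - vt)"
    using S by (rule ADRE) blast
  have "\<exists>r>0. ball x r \<inter> S \<in> null_sets M" for x
  proof (cases "x \<in> S")
    case True
    have "Hcal M vt (cball x 1 \<inter> S) \<le> ennreal k2 * emeasure M (cball x 1) * ennreal (1 powr - vt)"
      using True by (intro upper) auto
    also have "\<dots> < \<infinity>"
      by (simp add: emeasure_cball ennreal_mult_less_top)
    finally have "cball x 1 \<inter> S \<in> null_sets M"
      using vt cl by (intro Hcal_finite_imp_null[OF sets_M]) auto
    then have "ball x 1 \<inter> S \<in> null_sets M"
      by (rule null_sets_subset) (use cl in \<open>auto simp: sets_M\<close>)
    then show ?thesis
      by (intro exI[of _ 1]) auto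
  next
    case False
    then obtain r where "0 < r" "ball x r \<subseteq> - S"
      using cl by (meson ComplI open_Compl openE)
    then have "ball x r \<inter> S = {}"
      by auto
    with \<open>0 < r\<close> show ?thesis
      by (intro exI[of _ r]) auto
  qed
  then show ?thesis
    by (rule null_sets_locally)
qed

lemma Hcal_cball_Int_le:
  assumes upper: "\<And>x r. x \<in> S \<Longrightarrow> 0 < r \<Longrightarrow> r \<le> 1 \<Longrightarrow>
      Hcal M vt (cball x r \<inter> S) \<le> ennreal k2 * emeasure M (cball x r) * ennreal (r powr - vt)"
    and k2: "0 \<le> k2" and vt: "0 \<le> vt" and r: "0 < r" "r \<le> 1/2"
  shows "Hcal M vt (cball x r \<inter> S) \<le> ennreal (k2 * Cd\<^sup>2 * V r x * r powr - vt)"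
proof (cases "cball x r \<inter> S = {}")
  case True
  then show ?thesis
    by (simp add: metric_outer_measure.empty[OF metric_outer_measure_Hcal])
next
  case False
  then obtain u where u: "u \<in> S" "dist x u \<le> r"
    by auto
  have "Hcal M vt (cball x r \<inter> S) \<le> Hcal M vt (cball u (2 * r) \<inter> S)"
    using cball_subset_cball_double[of u x r] u(2)
    by (intro metric_outer_measure.mono[OF metric_outer_measure_Hcal]) (auto simp: dist_commute)
  also have "\<dots> \<le> ennreal (k2 * V (2 * r) u * (2 * r) powr - vt)"
    using upper[OF u(1), of "2 * r"] r k2 by (simp add: emeasure_cball ennreal_mult)
  also have "\<dots> \<le> ennreal (k2 * (Cd\<^sup>2 * V r x) * r powr - vt)"
  proof (intro ennreal_leI mult_mono)
    have "V (2 * r) u \<le> Cd * V r u"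
      using r by (intro V_double) auto
    also have "\<dots> \<le> Cd * (Cd * V r x)"
      using r u Cd_ge_1 by (intro mult_left_mono V_double_near) auto
    finally show "V (2 * r) u \<le> Cd\<^sup>2 * V r x"
      by (simp add: power2_eq_square)
    show "(2 * r) powr - vt \<le> r powr - vt"
      using r vt by (intro powr_mono2') auto
  qed (use k2 in auto)
  finally show ?thesis
    by (simp add: ac_simps)
qed

lemma codim_regular_Hrestr:
  assumes S: "ADR M vt S" and vt: "0 \<le> vt"
  shows "\<exists>\<kappa> K. codim_regular vt \<kappa> K (Hrestr M vt S)"
proof -
  obtain k1 k2 where cl: "closed S" and k: "0 < k1" "0 < k2"
    and lower: "\<And>x r. x \<in> S \<Longrightarrow> 0 < r \<Longrightarrow> r \<le> 1 \<Longrightarrow>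
      ennreal k1 * emeasure M (cball x r) * ennreal (r powr - vt) \<le> Hcal M vt (cball x r \<inter> S)"
    and upper: "\<And>x r. x \<in> S \<Longrightarrow> 0 < r \<Longrightarrow> r \<le> 1 \<Longrightarrow>
      Hcal M vt (cball x r \<inter> S) \<le> ennreal k2 * emeasure M (cball x r) * ennreal (r powr - vt)"
    using S by (rule ADRE) blast
  let ?H = "Hrestr M vt S"
  have "AE x in ?H. x \<in> S"
    using cl by (intro AE_I'[of "- S"]) (auto simp: null_sets_def sets_Hrestr emeasure_Hrestr
      metric_outer_measure.empty[OF metric_outer_measure_Hcal])
  then have "AE x in ?H. \<forall>r\<in>{0<..1}. ennreal (k1 * V r x * r powr - vt) \<le> emeasure ?H (cball x r)"
  proof eventually_elim
    case (elim x)
    then show ?case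
      using lower[of x] k by (auto simp: emeasure_Hrestr emeasure_cball ennreal_mult)
  qed
  moreover have "emeasure ?H (cball x r) \<le> ennreal (k2 * Cd\<^sup>2 * V r x * r powr - vt)"
    if "r \<in> {0<..1/2}" for x r
    unfolding emeasure_Hrestr[OF borel_closed[OF closed_cball]]
    by (rule Hcal_cball_Int_le[OF upper]) (use that k vt in auto)
  ultimately have "codim_regular vt k1 (k2 * Cd\<^sup>2) ?H"
    unfolding codim_regular_def using k Cd_ge_1 by (auto simp: sets_Hrestr)
  then show ?thesis
    by blast
qed

end

definition locally_doubling :: "'a::metric_space measure \<Rightarrow> bool" where
  "locally_doubling M \<longleftrightarrow>
    (\<forall>R>0. \<exists>C::real. \<forall>r\<in>{0<..R}. \<forall>x. emeasure M (cball x (2*r)) \<le> ennreal C * emeasure M (cball x r))"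

lemma locally_doublingE:
  assumes "locally_doubling M" "0 < R"
  obtains C :: real
  where "\<And>r x. 0 < r \<Longrightarrow> r \<le> R \<Longrightarrow> emeasure M (cball x (2*r)) \<le> ennreal C * emeasure M (cball x r)"
  using assms unfolding locally_doubling_def by (metis greaterThanAtMost_iff)

lemma locally_doubling_finite_cball:
  assumes M: "sets M = sets borel" and r0: "0 < r0" "emeasure M (cball x r0) < \<infinity>"
    and doubling: "locally_doubling M"
  shows "emeasure M (cball x r) < \<infinity>"
proof -
  have finite: "emeasure M (cball x (2 ^ n * r0)) < \<infinity>" for n
  proof (induction n)
    case (Suc n)
    have R: "0 < 2 ^ n * r0"
      using r0 by simp
    obtain C :: real where C: "\<And>r x. 0 < r \<Longrightarrow> r \<le> 2 ^ n * r0 \<Longrightarrow>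
        emeasure M (cball x (2*r)) \<le> ennreal C * emeasure M (cball x r)"
      using doubling R by (rule locally_doublingE) blast
    have "emeasure M (cball x (2 * (2 ^ n * r0))) \<le> ennreal C * emeasure M (cball x (2 ^ n * r0))"
      using R by (intro C) auto
    also have "\<dots> < \<infinity>"
      using Suc by (simp add: ennreal_mult_less_top)
    finally show ?case
      by (simp add: mult.assoc)
  qed (use r0 in simp)
  obtain n where "r / r0 < 2 ^ n"
    using real_arch_pow[of 2 "r / r0"] by auto
  then have "emeasure M (cball x r) \<le> emeasure M (cball x (2 ^ n * r0))"
    using r0 M by (intro emeasure_mono subset_cball) (simp_all add: field_simps)
  then show ?thesis
    using finite by (rule le_less_trans)
qed

lemma standing_space_imp_doubling_measure:
  assumes "standing_space M p"
  obtains Cd where "doubling_measure M Cd"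
proof -
  have M: "sets M = sets borel"
    and finite: "\<And>x. \<exists>r>0. emeasure M (cball x r) < \<infinity>"
    and pos: "\<And>x r. r > 0 \<Longrightarrow> emeasure M (cball x r) > 0"
    and doubling: "locally_doubling M"
    using assms unfolding standing_space_def locally_doubling_def by auto
  obtain C :: real where C: "\<And>r x. 0 < r \<Longrightarrow> r \<le> 1 \<Longrightarrow>
      emeasure M (cball x (2*r)) \<le> ennreal C * emeasure M (cball x r)"
    using doubling zero_less_one by (rule locally_doublingE) blast
  have "doubling_measure M (max 1 C)"
  proof
    show "emeasure M (cball x r) < \<infinity>" for x r
      using finite[of x] locally_doubling_finite_cball[OF M _ _ doubling] by blast
    fix x and r :: real assume "0 < r" "r \<le> 1"
    then have "emeasure M (cball x (2 * r)) \<le> ennreal C * emeasure M (cball x r)"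
      by (rule C)
    also have "\<dots> \<le> ennreal (max 1 C) * emeasure M (cball x r)"
      by (intro mult_right_mono ennreal_leI) auto
    finally show "emeasure M (cball x (2 * r)) \<le> ennreal (max 1 C) * emeasure M (cball x r)" .
  qed (use M pos in auto)
  then show ?thesis
    by (rule that)
qed

lemma (in doubling_measure) ADR_regular_family:
  assumes ADR: "\<And>i. i \<in> I \<Longrightarrow> ADR M (t i) (S i)" and t: "\<And>i. i \<in> I \<Longrightarrow> 0 \<le> t i"
    and "finite I" "1 \<le> p" "\<theta> \<le> p"
  obtains \<kappa> K where "regular_family M Cd I (\<lambda>i. Hrestr M (t i) (S i)) t \<kappa> K p \<theta>"
proof -
  have "\<forall>i\<in>I. \<exists>\<kappa> K. codim_regular (t i) \<kappa> K (Hrestr M (t i) (S i))"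
    using codim_regular_Hrestr[OF ADR t] by blast
  then obtain \<kappa> K where "\<And>i. i \<in> I \<Longrightarrow> codim_regular (t i) (\<kappa> i) (K i) (Hrestr M (t i) (S i))"
    by metis
  then have "regular_family M Cd I (\<lambda>i. Hrestr M (t i) (S i)) t \<kappa> K p \<theta>"
    using assms by unfold_locales auto
  then show ?thesis
    by (rule that)
qed

subsection \<open>Besov norms and the gluing functional\<close>

lemma Besov_eq:
  assumes "0 < p"
  shows "Besov M t (1 - t / p) p S f =
    epow (Lp_energy p (Hrestr M t S) f) (1 / p) + epow (osc_energy (p - t) p (Hrestr M t S) f) (1 / p)"
proof -
  have "real (Suc k) * (1 - t / p) * p = real (Suc k) * (p - t)" for k
    using assms by (simp add: field_simps)
  then show ?thesis
    by (simp only: Besov_def Lpnorm_def Lp_energy_def osc_energy_def osc_level_def)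
qed

lemma GL_eq:
  "GL M p N th S f = epow (\<Sum>i\<in>{1..N}. \<Sum>j\<in>{1..N} - {i}.
    gluing_energy M (p - th i - th j) p (Hrestr M (th i) (S i)) (Hrestr M (th j) (S j)) f) (1 / p)"
proof -
  have "{(i, j). i \<in> {1..N} \<and> j \<in> {1..N} \<and> i \<noteq> j} = (SIGMA i:{1..N}. {1..N} - {i})"
    by auto
  then show ?thesis
    by (simp add: GL_def gluing_energy_def gluing_level_def gluing_integral_def sum.Sigma)
qed

lemma (in regular_family) root_energy_le:
  "epow (energy f) (1 / p) \<le>
    (\<Sum>i\<in>I. epow (Lp_energy p (H i) f) (1 / p) + epow (osc_energy (p - t i) p (H i) f) (1 / p)) +
    epow (\<Sum>i\<in>I. \<Sum>j\<in>I - {i}. gluing_energy M (p - t i - t j) p (H i) (H j) f) (1 / p)"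
proof -
  have p: "0 \<le> 1 / p" "1 / p \<le> 1"
    using p_ge_1 by auto
  have "epow (\<Sum>i\<in>I. Lp_energy p (H i) f + osc_energy (p - t i) p (H i) f) (1 / p)
      \<le> (\<Sum>i\<in>I. epow (Lp_energy p (H i) f + osc_energy (p - t i) p (H i) f) (1 / p))"
    by (intro epow_sum_le finite_I p)
  also have "\<dots> \<le> (\<Sum>i\<in>I. epow (Lp_energy p (H i) f) (1 / p) + epow (osc_energy (p - t i) p (H i) f) (1 / p))"
    by (intro sum_mono epow_add_le p)
  finally show ?thesis
    unfolding energy_def by (rule order_trans[OF epow_add_le[OF p] add_right_mono])
qed

theorem theorem3p12:
  fixes M :: "'a::{complete_space, second_countable_topology} measure"
    and p \<theta>low \<theta> :: real and N :: nat and th \<sigma>i :: "nat \<Rightarrow> real" and S :: "nat \<Rightarrow> 'a set"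
    and \<sigma> :: real
  assumes space: "standing_space M p"
    and th_low: "0 \<le> \<theta>low" "\<theta>low < min p (Qlow M)"
    and th_range: "\<theta>low \<le> \<theta>" "\<theta> < p"
    and N2: "2 \<le> N"
    and th_pos: "0 < th 1"
    and th_mono: "\<forall>i\<in>{1..<N}. th i < th (Suc i)"
    and th_N: "th N = \<theta>low"
    and ADR: "\<forall>i\<in>{1..N}. ADR M (th i) (S i)"
    and sig_i: "\<forall>i\<in>{1..N}. 0 < \<sigma>i i \<and> \<sigma>i i < 1 \<and> porous (S i) (\<sigma>i i)"
    and sig: "0 < \<sigma>" "\<sigma> \<le> (\<Prod>i\<in>{1..N}. 2 * \<sigma>i i / 3)"
  shows "\<exists>C>0. \<forall>f::'a \<Rightarrow> real. f \<in> borel_measurable borel \<longrightarrow>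
            (\<forall>i\<in>{1..N}. (\<integral>\<^sup>+x. epow (ennreal \<bar>f x\<bar>) p \<partial>Hrestr M (th i) (S i)) < \<infinity>) \<longrightarrow>
          BN M p \<theta> (mk M \<theta> N th S) (\<Union>i\<in>{1..N}. S i) \<sigma> f
            \<le> ennreal C * ((\<Sum>i\<in>{1..N}. Besov M (th i) (1 - th i / p) p (S i) f) + GL M p N th S f)"
proof -
  have p: "1 < p"
    using space by (simp add: standing_space_def)
  have "0 < th i" if "1 \<le> i" "i \<le> N" for i
    using that th_pos th_mono by (induction i rule: dec_induct) force+
  then have th: "0 < th i" if "i \<in> {1..N}" for i
    using that by simp
  obtain Cd where "doubling_measure M Cd"
    using space by (rule standing_space_imp_doubling_measure)
  then interpret doubling_measure M Cd .
  obtain \<kappa> K where "regular_family M Cd {1..N} (\<lambda>i. Hrestr M (th i) (S i)) th \<kappa> K p \<theta>"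
    by (rule ADR_regular_family[of "{1..N}" th S p \<theta>]) (use ADR th p th_range in \<open>auto intro: less_imp_le\<close>)
  then interpret regular_family M Cd "{1..N}" "\<lambda>i. Hrestr M (th i) (S i)" th \<kappa> K p \<theta> .
  have m: "mk M \<theta> N th S = m"
    by (rule ext) (simp only: mk_def m_def sum_measure_def level_coeff_def)
  have "(\<Union>i\<in>{1..N}. S i) \<in> null_sets M"
    using ADR th by (intro null_sets_UN' ADR_imp_null) auto
  then obtain C where "0 \<le> C" and C: "\<And>f. f \<in> borel_measurable borel \<Longrightarrow>
      BN M p \<theta> m (\<Union>i\<in>{1..N}. S i) \<sigma> f \<le> ennreal (1 + C) * epow (energy f) (1 / p)"
    using BN_le_energy by blast
  have "epow (energy f) (1 / p) \<le> (\<Sum>i\<in>{1..N}. Besov M (th i) (1 - th i / p) p (S i) f) + GL M p N th S f" for f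
    using root_energy_le p by (simp add: Besov_eq GL_eq)
  then show ?thesis
    using \<open>0 \<le> C\<close> order_trans[OF C mult_left_mono] unfolding m by (intro exI[of _ "1 + C"]) auto
qed

end
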